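(* Let $V$ be a generalized bijective variety with theory $T$ in the language $L=\{f_1,\ldots,f_m\}$ of unary function symbols. (1) Any elementary first-order $L$-sentence $\varphi$ is equivalent over $T$ to a sentence $\varphi^*$ that is a finite Boolean combination of local sentences. (2) Any elementary first-order $L$-formula $\varphi(\bar x)$ with free variables $\bar x$ is equivalent over $T$ to a formula $\varphi^*(\bar x)$ that is a finite Boolean combination of local sentences and local formulas. In fact, we may take $\varphi^*(\bar x)$ to be a finite disjunction of formulas $\alpha_i(\bar x)\ \&\ \beta_i$, where for each $i$, $\alpha_i(\bar x)$ is a single local formula and $\beta_i$ is a finite conjunction of local sentences and negations of local sentences.
   Context: A variety is a class of structures axiomatized by universally quantified equations; its theory $T$ is the set of logical consequences of the axioms. $V$ is generalized bijective if for each $i$, $T\vdash(\forall x,y)(f_i(x)=f_i(y)\to x=y)$ and $T\vdash(\forall y)(\exists x)\,f_i(x)=y$. For an $L$-structure $\mathcal{A}$, the Gaifman graph is the undirected graph on the universe of $\mathcal{A}$ with an edge between $x$ and $y$ iff $f_i(x)=y$ or $f_i(y)=x$ for some $i$. The distance $d(x,y)$ is the least length of a path from $x$ to $y$ (infinite if there is none), and $d^{>2r}(x,y)$ is the formula expressing $d(x,y)>2r$. $B_r(a)=\{x: d(a,x)\le r\}$, and $B_r(\bar a)=\bigcup_i B_r(a_i)$; these are regarded as substructures with the functions $f_i$ treated as binary relations. For each $r,n$ fix a finite set $C_{r,n}$ of $L$-formulas $\alpha(\bar x)$ in an $n$-tuple of variables such that (i) for each $\mathcal{A}\in V$, each $n$-tuple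 in $\mathcal{A}$ satisfies a unique $\alpha\in C_{r,n}$; (ii) for all $\mathcal{A},\mathcal{A}'\in V$, if $n$-tuples $\bar a$ in $\mathcal{A}$ and $\bar a'$ in $\mathcal{A}'$ satisfy the same $\alpha\in C_{r,n}$, then there is an isomorphism from $B_r(\bar a)$ onto $B_r(\bar a')$ taking $\bar a$ to $\bar a'$. (Such sets exist for any generalized bijective variety: the formulas describe the atomic diagram of $B_r(\bar x)$, and may be taken existential, or universal.) The $r$-local formulas are those in $C_{r,n}$ for various $n$. The $r$-local sentences are those of the form $(\exists v_1,\ldots,v_s)\big(\bigwedge_i\alpha_i(v_i)\ \&\ \bigwedge_{i<j}d^{>2r}(v_i,v_j)\big)$ for some $s$ and $\alpha_i\in C_{r,1}$, or $(\exists v)\alpha(v)$ for some $\alpha\in C_{r,1}$. A formula or sentence is local if it is $r$-local for some $r$. *)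

theory Defs
  imports Main "HOL-Library.Extended_Nat" "HOL-Library.Countable_Set" "HOL-Library.Infinite_Typeclass"
begin

section \<open>Syntax\<close>

text \<open>
  The unary function symbols are indexed by natural numbers; the language with \<open>m\<close> symbols
  uses the indices \<open>i < m\<close>. Variables are de Bruijn indices: a quantifier binds index 0 and
  shifts the other indices by one.
\<close>

datatype trm = Var nat | App nat trm

datatype fm =
    Eq trm trm | Bot | Neg fm | And fm fm | Or fm fm | Ex fm | All fm

abbreviation Imp :: "fm \<Rightarrow> fm \<Rightarrow> fm" where
  "Imp \<phi> \<psi> \<equiv> Or (Neg \<phi>) \<psi>"

abbreviation Iff :: "fm \<Rightarrow> fm \<Rightarrow> fm" where
  "Iff \<phi> \<psi> \<equiv> And (Imp \<phi> \<psi>) (Imp \<psi> \<phi>)"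

definition Conjs :: "fm list \<Rightarrow> fm" where
  "Conjs \<phi>s = foldr And \<phi>s (Neg Bot)"

definition Disjs :: "fm list \<Rightarrow> fm" where
  "Disjs \<phi>s = foldr Or \<phi>s Bot"

primrec is_term :: "nat \<Rightarrow> nat \<Rightarrow> trm \<Rightarrow> bool" where
  "is_term m n (Var k) \<longleftrightarrow> k < n"
| "is_term m n (App i t) \<longleftrightarrow> i < m \<and> is_term m n t"

text \<open>
  \<open>is_formula m n \<phi>\<close>: \<open>\<phi>\<close> is a formula of the language with \<open>m\<close> symbols whose free variables are
  among \<open>0, \<dots>, n - 1\<close>, i.e. a formula in the \<open>n\<close>-tuple of variables \<open>(0, \<dots>, n - 1)\<close>.
  Sentences are the case \<open>n = 0\<close>.
\<close>

primrec is_formula :: "nat \<Rightarrow> nat \<Rightarrow> fm \<Rightarrow> bool" where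
  "is_formula m n (Eq s t) \<longleftrightarrow> is_term m n s \<and> is_term m n t"
| "is_formula m n Bot \<longleftrightarrow> True"
| "is_formula m n (Neg \<phi>) \<longleftrightarrow> is_formula m n \<phi>"
| "is_formula m n (And \<phi> \<psi>) \<longleftrightarrow> is_formula m n \<phi> \<and> is_formula m n \<psi>"
| "is_formula m n (Or \<phi> \<psi>) \<longleftrightarrow> is_formula m n \<phi> \<and> is_formula m n \<psi>"
| "is_formula m n (Ex \<phi>) \<longleftrightarrow> is_formula m (Suc n) \<phi>"
| "is_formula m n (All \<phi>) \<longleftrightarrow> is_formula m (Suc n) \<phi>"

primrec rename_term :: "(nat \<Rightarrow> nat) \<Rightarrow> trm \<Rightarrow> trm" where
  "rename_term \<sigma> (Var k) = Var (\<sigma> k)"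
| "rename_term \<sigma> (App i t) = App i (rename_term \<sigma> t)"

text \<open>Capture-avoiding substitution of the variables \<open>\<sigma> k\<close> for the free variables \<open>k\<close>.\<close>

primrec rename :: "(nat \<Rightarrow> nat) \<Rightarrow> fm \<Rightarrow> fm" where
  "rename \<sigma> (Eq s t) = Eq (rename_term \<sigma> s) (rename_term \<sigma> t)"
| "rename \<sigma> Bot = Bot"
| "rename \<sigma> (Neg \<phi>) = Neg (rename \<sigma> \<phi>)"
| "rename \<sigma> (And \<phi> \<psi>) = And (rename \<sigma> \<phi>) (rename \<sigma> \<psi>)"
| "rename \<sigma> (Or \<phi> \<psi>) = Or (rename \<sigma> \<phi>) (rename \<sigma> \<psi>)"
| "rename \<sigma> (Ex \<phi>) = Ex (rename (case_nat 0 (Suc \<circ> \<sigma>)) \<phi>)"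
| "rename \<sigma> (All \<phi>) = All (rename (case_nat 0 (Suc \<circ> \<sigma>)) \<phi>)"

section \<open>Structures, varieties and their theories\<close>

datatype 'a struct = Struct (universe: "'a set") (fn: "nat \<Rightarrow> 'a \<Rightarrow> 'a")

definition is_structure :: "nat \<Rightarrow> 'a struct \<Rightarrow> bool" where
  "is_structure m A \<longleftrightarrow> universe A \<noteq> {} \<and> (\<forall>i<m. \<forall>x\<in>universe A. fn A i x \<in> universe A)"

primrec val :: "'a struct \<Rightarrow> 'a list \<Rightarrow> trm \<Rightarrow> 'a" where
  "val A as (Var k) = as ! k"
| "val A as (App i t) = fn A i (val A as t)"

text \<open>\<open>sat A as \<phi>\<close>: the tuple \<open>as\<close> satisfies \<open>\<phi>\<close> in \<open>A\<close>; entry \<open>as ! k\<close> interprets variable \<open>k\<close>.\<close>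

primrec sat :: "'a struct \<Rightarrow> 'a list \<Rightarrow> fm \<Rightarrow> bool" where
  "sat A as (Eq s t) \<longleftrightarrow> val A as s = val A as t"
| "sat A as Bot \<longleftrightarrow> False"
| "sat A as (Neg \<phi>) \<longleftrightarrow> \<not> sat A as \<phi>"
| "sat A as (And \<phi> \<psi>) \<longleftrightarrow> sat A as \<phi> \<and> sat A as \<psi>"
| "sat A as (Or \<phi> \<psi>) \<longleftrightarrow> sat A as \<phi> \<or> sat A as \<psi>"
| "sat A as (Ex \<phi>) \<longleftrightarrow> (\<exists>x\<in>universe A. sat A (x # as) \<phi>)"
| "sat A as (All \<phi>) \<longleftrightarrow> (\<forall>x\<in>universe A. sat A (x # as) \<phi>)"

definition equation_axiom :: "nat \<Rightarrow> fm \<Rightarrow> bool" where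
  "equation_axiom m \<psi> \<longleftrightarrow>
    (\<exists>n s t. is_term m n s \<and> is_term m n t \<and> \<psi> = (All ^^ n) (Eq s t))"

text \<open>
  The class of structures axiomatized by \<open>E\<close>, with universes contained in the type \<open>'a\<close>.
\<close>

definition Mod :: "nat \<Rightarrow> fm set \<Rightarrow> 'a struct set" where
  "Mod m E = {A. is_structure m A \<and> (\<forall>\<psi>\<in>E. sat A [] \<psi>)}"

text \<open>
  For \<open>V = Mod m E\<close> this is the set of logical consequences of \<open>E\<close>, so \<open>T \<turnstile> \<phi>\<close> is
  \<open>\<phi> \<in> T\<close>. Lemma \<open>theory_of_Mod_type_independent\<close> below shows that it does not depend on the
  infinite type \<open>'a\<close> from which the universes are drawn.
\<close>

definition theory_of :: "nat \<Rightarrow> 'a struct set \<Rightarrow> fm set" where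
  "theory_of m V = {\<phi>. is_formula m 0 \<phi> \<and> (\<forall>A\<in>V. sat A [] \<phi>)}"

definition generalized_bijective :: "nat \<Rightarrow> fm set \<Rightarrow> bool" where
  "generalized_bijective m T \<longleftrightarrow> (\<forall>i<m.
     All (All (Imp (Eq (App i (Var 1)) (App i (Var 0))) (Eq (Var 1) (Var 0)))) \<in> T \<and>
     All (Ex (Eq (App i (Var 0)) (Var 1))) \<in> T)"

definition equivalent_over :: "fm set \<Rightarrow> nat \<Rightarrow> fm \<Rightarrow> fm \<Rightarrow> bool" where
  "equivalent_over T n \<phi> \<psi> \<longleftrightarrow> (All ^^ n) (Iff \<phi> \<psi>) \<in> T"

section \<open>Gaifman graph\<close>

definition gaifman :: "nat \<Rightarrow> 'a struct \<Rightarrow> 'a rel" where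
  "gaifman m A = {(x, y). x \<in> universe A \<and> y \<in> universe A \<and> (\<exists>i<m. fn A i x = y \<or> fn A i y = x)}"

definition gdist :: "nat \<Rightarrow> 'a struct \<Rightarrow> 'a \<Rightarrow> 'a \<Rightarrow> enat" where
  "gdist m A x y = Inf {enat k |k. (x, y) \<in> gaifman m A ^^ k}"

definition gball :: "nat \<Rightarrow> 'a struct \<Rightarrow> nat \<Rightarrow> 'a list \<Rightarrow> 'a set" where
  "gball m A r as = (\<Union>a\<in>set as. {x \<in> universe A. gdist m A a x \<le> enat r})"

text \<open>
  Isomorphism between the substructures with universes \<open>B\<close> and \<open>B'\<close>, where the functions are
  treated as binary relations (\<open>B\<close> and \<open>B'\<close> need not be closed under them).
\<close>

definition rel_iso ::
  "nat \<Rightarrow> 'a struct \<Rightarrow> 'a set \<Rightarrow> 'b struct \<Rightarrow> 'b set \<Rightarrow> ('a \<Rightarrow> 'b) \<Rightarrow> bool" where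
  "rel_iso m A B A' B' h \<longleftrightarrow> bij_betw h B B' \<and>
    (\<forall>i<m. \<forall>x\<in>B. \<forall>y\<in>B. fn A i x = y \<longleftrightarrow> fn A' i (h x) = h y)"

definition adj_fm :: "nat \<Rightarrow> nat \<Rightarrow> nat \<Rightarrow> fm" where
  "adj_fm m x y =
    Disjs (map (\<lambda>i. Or (Eq (App i (Var x)) (Var y)) (Eq (App i (Var y)) (Var x))) [0..<m])"

text \<open>The formula expressing \<open>d(x, y) \<le> k\<close>; under the quantifier the variables \<open>x\<close>, \<open>y\<close> are shifted.\<close>

primrec dist_le_fm :: "nat \<Rightarrow> nat \<Rightarrow> nat \<Rightarrow> nat \<Rightarrow> fm" where
  "dist_le_fm m 0 x y = Eq (Var x) (Var y)"
| "dist_le_fm m (Suc k) x y =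
    Or (dist_le_fm m k x y) (Ex (And (adj_fm m (Suc x) 0) (dist_le_fm m k 0 (Suc y))))"

definition dist_gt_fm :: "nat \<Rightarrow> nat \<Rightarrow> nat \<Rightarrow> nat \<Rightarrow> fm" where
  "dist_gt_fm m k x y = Neg (dist_le_fm m k x y)"

section \<open>Local formulas and sentences\<close>

definition local_family :: "nat \<Rightarrow> 'a struct set \<Rightarrow> (nat \<Rightarrow> nat \<Rightarrow> fm set) \<Rightarrow> bool" where
  "local_family m V C \<longleftrightarrow> (\<forall>r n.
     finite (C r n) \<and>
     (\<forall>\<alpha>\<in>C r n. is_formula m n \<alpha>) \<and>
     (\<forall>A\<in>V. \<forall>as. length as = n \<and> set as \<subseteq> universe A \<longrightarrow> (\<exists>!\<alpha>. \<alpha> \<in> C r n \<and> sat A as \<alpha>)) \<and>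
     (\<forall>A\<in>V. \<forall>A'\<in>V. \<forall>as as'. \<forall>\<alpha>\<in>C r n.
        length as = n \<and> set as \<subseteq> universe A \<and> length as' = n \<and> set as' \<subseteq> universe A' \<and>
        sat A as \<alpha> \<and> sat A' as' \<alpha> \<longrightarrow>
        (\<exists>h. rel_iso m A (gball m A r as) A' (gball m A' r as') h \<and> map h as = as')))"

definition local_formula :: "(nat \<Rightarrow> nat \<Rightarrow> fm set) \<Rightarrow> nat \<Rightarrow> fm \<Rightarrow> bool" where
  "local_formula C n \<alpha> \<longleftrightarrow> (\<exists>r. \<alpha> \<in> C r n)"

text \<open>
  The sentence \<open>(\<exists>v\<^sub>0, \<dots>, v\<^sub>s\<^sub>-\<^sub>1) (\<And>\<^sub>i \<alpha>\<^sub>i(v\<^sub>i) & \<And>\<^sub>i\<^sub><\<^sub>j d(v\<^sub>i, v\<^sub>j) > 2 r)\<close>, with \<open>v\<^sub>i\<close> the variable of index \<open>i\<close>.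
\<close>

definition scattered_sentence :: "nat \<Rightarrow> nat \<Rightarrow> fm list \<Rightarrow> fm" where
  "scattered_sentence m r \<alpha>s = (let s = length \<alpha>s in
    (Ex ^^ s) (And
      (Conjs [rename (\<lambda>_. i) (\<alpha>s ! i). i \<leftarrow> [0..<s]])
      (Conjs [dist_gt_fm m (2 * r) i j. j \<leftarrow> [0..<s], i \<leftarrow> [0..<j]])))"

definition r_local_sentence :: "nat \<Rightarrow> (nat \<Rightarrow> nat \<Rightarrow> fm set) \<Rightarrow> nat \<Rightarrow> fm \<Rightarrow> bool" where
  "r_local_sentence m C r \<phi> \<longleftrightarrow>
    (\<exists>\<alpha>s. \<alpha>s \<noteq> [] \<and> set \<alpha>s \<subseteq> C r 1 \<and> \<phi> = scattered_sentence m r \<alpha>s) \<or>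
    (\<exists>\<alpha>\<in>C r 1. \<phi> = Ex \<alpha>)"

definition local_sentence :: "nat \<Rightarrow> (nat \<Rightarrow> nat \<Rightarrow> fm set) \<Rightarrow> fm \<Rightarrow> bool" where
  "local_sentence m C \<phi> \<longleftrightarrow> (\<exists>r. r_local_sentence m C r \<phi>)"

text \<open>Finite Boolean combinations, including the empty disjunction \<open>Bot\<close>.\<close>

inductive bool_comb :: "(fm \<Rightarrow> bool) \<Rightarrow> fm \<Rightarrow> bool" for P where
  atom: "P \<phi> \<Longrightarrow> bool_comb P \<phi>"
| bot: "bool_comb P Bot"
| neg: "bool_comb P \<phi> \<Longrightarrow> bool_comb P (Neg \<phi>)"
| conj: "bool_comb P \<phi> \<Longrightarrow> bool_comb P \<psi> \<Longrightarrow> bool_comb P (And \<phi> \<psi>)"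
| disj: "bool_comb P \<phi> \<Longrightarrow> bool_comb P \<psi> \<Longrightarrow> bool_comb P (Or \<phi> \<psi>)"

definition local_normal_form :: "nat \<Rightarrow> (nat \<Rightarrow> nat \<Rightarrow> fm set) \<Rightarrow> nat \<Rightarrow> fm \<Rightarrow> bool" where
  "local_normal_form m C n \<phi> \<longleftrightarrow> (\<exists>ds.
     (\<forall>(\<alpha>, \<beta>s) \<in> set ds. local_formula C n \<alpha> \<and>
        (\<forall>\<beta>\<in>set \<beta>s. local_sentence m C \<beta> \<or> (\<exists>\<gamma>. local_sentence m C \<gamma> \<and> \<beta> = Neg \<gamma>))) \<and>
     \<phi> = Disjs [And \<alpha> (Conjs \<beta>s). (\<alpha>, \<beta>s) \<leftarrow> ds])"

section \<open>Sanity checks on the encoding\<close>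

lemma val_in_universe:
  assumes "is_structure m A" "set as \<subseteq> universe A" "is_term m (length as) t"
  shows "val A as t \<in> universe A"
  using assms(3) by (induction t) (use assms nth_mem in \<open>fastforce simp: is_structure_def\<close>)+

lemma sat_Conjs [simp]: "sat A as (Conjs \<phi>s) \<longleftrightarrow> (\<forall>\<phi>\<in>set \<phi>s. sat A as \<phi>)"
  by (induction \<phi>s) (auto simp: Conjs_def)

lemma sat_Disjs [simp]: "sat A as (Disjs \<phi>s) \<longleftrightarrow> (\<exists>\<phi>\<in>set \<phi>s. sat A as \<phi>)"
  by (induction \<phi>s) (auto simp: Disjs_def)

lemma sat_All_pow:
  "sat A as ((All ^^ n) \<phi>) \<longleftrightarrow>
    (\<forall>xs. length xs = n \<and> set xs \<subseteq> universe A \<longrightarrow> sat A (xs @ as) \<phi>)"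
proof (induction n arbitrary: as)
  case (Suc n)
  have "sat A as ((All ^^ Suc n) \<phi>) \<longleftrightarrow>
     (\<forall>x\<in>universe A. \<forall>xs. length xs = n \<and> set xs \<subseteq> universe A \<longrightarrow> sat A (xs @ x # as) \<phi>)"
    by (simp add: Suc.IH)
  also have "\<dots> \<longleftrightarrow> (\<forall>ys. length ys = Suc n \<and> set ys \<subseteq> universe A \<longrightarrow> sat A (ys @ as) \<phi>)"
  proof safe
    fix ys assume *: "\<forall>x\<in>universe A. \<forall>xs. length xs = n \<and> set xs \<subseteq> universe A \<longrightarrow> sat A (xs @ x # as) \<phi>"
      "length ys = Suc n" "set ys \<subseteq> universe A"
    then obtain x xs where "ys = xs @ [x]" by (cases ys rule: rev_cases) auto
    with * show "sat A (ys @ as) \<phi>" by auto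
  next
    fix x xs assume "\<forall>ys. length ys = Suc (length xs) \<and> set ys \<subseteq> universe A \<longrightarrow> sat A (ys @ as) \<phi>"
      "x \<in> universe A" "set xs \<subseteq> universe A"
    then show "sat A (xs @ x # as) \<phi>" by (force dest: spec[of _ "xs @ [x]"])
  qed
  finally show ?case .
qed simp

lemma sat_Ex_pow:
  "sat A as ((Ex ^^ n) \<phi>) \<longleftrightarrow>
    (\<exists>xs. length xs = n \<and> set xs \<subseteq> universe A \<and> sat A (xs @ as) \<phi>)"
proof -
  have "sat A as (Neg ((Ex ^^ n) \<phi>)) \<longleftrightarrow> sat A as ((All ^^ n) (Neg \<phi>))"
    by (induction n arbitrary: as) auto
  then show ?thesis by (auto simp: sat_All_pow)
qed

lemma val_rename_term:
  assumes "is_term m (length bs) t" "\<forall>k<length bs. as ! \<sigma> k = bs ! k"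
  shows "val A as (rename_term \<sigma> t) = val A bs t"
  using assms(1) by (induction t) (use assms(2) in auto)

lemma sat_rename:
  assumes "is_formula m (length bs) \<phi>" "\<forall>k<length bs. as ! \<sigma> k = bs ! k"
  shows "sat A as (rename \<sigma> \<phi>) \<longleftrightarrow> sat A bs \<phi>"
  using assms
proof (induction \<phi> arbitrary: as bs \<sigma>)
  case (Eq s t)
  then show ?case using val_rename_term[of m bs s as \<sigma> A] val_rename_term[of m bs t as \<sigma> A] by simp
next
  case (Ex \<phi>)
  have "sat A (x # as) (rename (case_nat 0 (Suc \<circ> \<sigma>)) \<phi>) \<longleftrightarrow> sat A (x # bs) \<phi>" for x
    by (rule Ex.IH) (use Ex.prems in \<open>auto simp: nth_Cons split: nat.split\<close>)
  then show ?case by simp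
next
  case (All \<phi>)
  have "sat A (x # as) (rename (case_nat 0 (Suc \<circ> \<sigma>)) \<phi>) \<longleftrightarrow> sat A (x # bs) \<phi>" for x
    by (rule All.IH) (use All.prems in \<open>auto simp: nth_Cons split: nat.split\<close>)
  then show ?case by simp
next
  case (And \<phi> \<psi>)
  have "sat A as (rename \<sigma> \<phi>) \<longleftrightarrow> sat A bs \<phi>" "sat A as (rename \<sigma> \<psi>) \<longleftrightarrow> sat A bs \<psi>"
    using And by (auto simp del: all_simps)
  then show ?case by simp
next
  case (Or \<phi> \<psi>)
  have "sat A as (rename \<sigma> \<phi>) \<longleftrightarrow> sat A bs \<phi>" "sat A as (rename \<sigma> \<psi>) \<longleftrightarrow> sat A bs \<psi>"
    using Or by (auto simp del: all_simps)
  then show ?case by simp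
qed simp_all

lemma sat_dist_le_fm:
  assumes "x < length as" "y < length as" "set as \<subseteq> universe A"
  shows "sat A as (dist_le_fm m k x y) \<longleftrightarrow> gdist m A (as ! x) (as ! y) \<le> enat k"
proof -
  have adj: "sat A as (adj_fm m x y) \<longleftrightarrow> (as ! x, as ! y) \<in> gaifman m A"
    if "x < length as" "y < length as" "set as \<subseteq> universe A" for as x y
    using that nth_mem[of x as] nth_mem[of y as] by (auto simp: adj_fm_def gaifman_def)
  have step: "(\<exists>j\<le>Suc k. (a, b) \<in> R ^^ j) \<longleftrightarrow>
      (\<exists>j\<le>k. (a, b) \<in> R ^^ j) \<or> (\<exists>c. (a, c) \<in> R \<and> (\<exists>j\<le>k. (c, b) \<in> R ^^ j))" for k a b and R :: "'a rel"
  proof safe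
    fix j assume "j \<le> Suc k" "(a, b) \<in> R ^^ j" and n: "\<nexists>c. (a, c) \<in> R \<and> (\<exists>j\<le>k. (c, b) \<in> R ^^ j)"
    then show "\<exists>j\<le>k. (a, b) \<in> R ^^ j"
      by (cases j) (auto simp del: relpow.simps(2) dest!: relpow_Suc_D2 intro: exI[of _ 0])
  next
    fix c j assume "(a, c) \<in> R" "j \<le> k" "(c, b) \<in> R ^^ j"
    then show "\<exists>j\<le>Suc k. (a, b) \<in> R ^^ j"
      by (intro exI[of _ "Suc j"]) (auto simp del: relpow.simps(2) intro: relpow_Suc_I2)
  qed (use le_SucI in blast)
  have "sat A as (dist_le_fm m k x y) \<longleftrightarrow> (\<exists>j\<le>k. (as ! x, as ! y) \<in> gaifman m A ^^ j)"
    using assms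
  proof (induction k arbitrary: as x y)
    case (Suc k)
    have "(\<exists>c. (as ! x, c) \<in> gaifman m A \<and> (\<exists>j\<le>k. (c, as ! y) \<in> gaifman m A ^^ j)) \<longleftrightarrow>
      (\<exists>c\<in>universe A. (as ! x, c) \<in> gaifman m A \<and> (\<exists>j\<le>k. (c, as ! y) \<in> gaifman m A ^^ j))"
      by (auto simp: gaifman_def)
    then show ?case using Suc by (simp add: adj step[of k])
  qed simp
  also have "\<dots> \<longleftrightarrow> gdist m A (as ! x) (as ! y) \<le> enat k"
  proof
    assume "\<exists>j\<le>k. (as ! x, as ! y) \<in> gaifman m A ^^ j"
    then obtain j where j: "j \<le> k" "(as ! x, as ! y) \<in> gaifman m A ^^ j" by blast
    then have "gdist m A (as ! x) (as ! y) \<le> enat j"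
      unfolding gdist_def by (intro Inf_lower) auto
    with j show "gdist m A (as ! x) (as ! y) \<le> enat k"
      by (meson enat_ord_simps(1) order_trans)
  next
    assume "gdist m A (as ! x) (as ! y) \<le> enat k"
    then have "gdist m A (as ! x) (as ! y) < enat (Suc k)"
      by (metis enat_ord_simps(2) lessI order_le_less_trans)
    then show "\<exists>j\<le>k. (as ! x, as ! y) \<in> gaifman m A ^^ j"
      unfolding gdist_def Inf_less_iff by (auto simp: less_Suc_eq_le)
  qed
  finally show ?thesis .
qed

lemma sat_dist_gt_fm:
  assumes "x < length as" "y < length as" "set as \<subseteq> universe A"
  shows "sat A as (dist_gt_fm m k x y) \<longleftrightarrow> gdist m A (as ! x) (as ! y) > enat k"
  using sat_dist_le_fm[OF assms] by (simp add: dist_gt_fm_def not_le)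

lemma sat_scattered_sentence:
  assumes "\<forall>\<alpha>\<in>set \<alpha>s. is_formula m 1 \<alpha>"
  shows "sat A [] (scattered_sentence m r \<alpha>s) \<longleftrightarrow>
    (\<exists>vs. length vs = length \<alpha>s \<and> set vs \<subseteq> universe A \<and>
      (\<forall>i<length vs. sat A [vs ! i] (\<alpha>s ! i)) \<and>
      (\<forall>j<length vs. \<forall>i<j. gdist m A (vs ! i) (vs ! j) > enat (2 * r)))"
proof -
  have "sat A vs (rename (\<lambda>_. i) (\<alpha>s ! i)) \<longleftrightarrow> sat A [vs ! i] (\<alpha>s ! i)"
    if "i < length \<alpha>s" for vs i
    using that assms by (intro sat_rename) auto
  then show ?thesis
    unfolding scattered_sentence_def Let_def sat_Ex_pow
    by (intro ex_cong1) (auto simp: sat_dist_gt_fm)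
qed

lemma is_formula_All_pow [simp]: "is_formula m k ((All ^^ n) \<phi>) \<longleftrightarrow> is_formula m (n + k) \<phi>"
  by (induction n arbitrary: k) auto

instance trm :: countable by countable_datatype
instance fm :: countable by countable_datatype

lemma val_image:
  assumes "is_structure m A" "inj_on h (universe A)" "set as \<subseteq> universe A" "is_term m (length as) t"
  shows "val (Struct (h ` universe A) (\<lambda>i. h \<circ> fn A i \<circ> inv_into (universe A) h)) (map h as) t = h (val A as t)"
  using assms(4) by (induction t) (use assms val_in_universe[OF assms(1,3)] in auto)

lemma sat_image:
  assumes "is_structure m A" "inj_on h (universe A)" "set as \<subseteq> universe A" "is_formula m (length as) \<phi>"
  shows "sat (Struct (h ` universe A) (\<lambda>i. h \<circ> fn A i \<circ> inv_into (universe A) h)) (map h as) \<phi> \<longleftrightarrow> sat A as \<phi>"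
  using assms(3,4)
proof (induction \<phi> arbitrary: as)
  case (Eq s t)
  then have "is_term m (length as) s" "is_term m (length as) t" by simp_all
  with Eq.prems(1) show ?case
    using inj_on_eq_iff[OF assms(2)]
    by (simp only: sat.simps val_image[OF assms(1,2)] val_in_universe[OF assms(1)])
next
  case (Ex \<phi>)
  then show ?case using Ex.IH[of "_ # as"] by auto
next
  case (All \<phi>)
  then show ?case using All.IH[of "_ # as"] by auto
qed simp_all

text \<open>Downward Loewenheim--Skolem theorem.\<close>

lemma countable_elementary_substructure:
  assumes A: "is_structure m A"
  obtains B where "is_structure m B" "countable (universe B)"
    "\<And>as \<phi>. set as \<subseteq> universe B \<Longrightarrow> is_formula m (length as) \<phi> \<Longrightarrow> sat B as \<phi> \<longleftrightarrow> sat A as \<phi>"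
proof -
  define w where "w = (\<lambda>(as, \<phi>). SOME x. x \<in> universe A \<and> (sat A as (Ex \<phi>) \<longrightarrow> sat A (x # as) \<phi>))"
  have w: "w (as, \<phi>) \<in> universe A" "sat A as (Ex \<phi>) \<Longrightarrow> sat A (w (as, \<phi>) # as) \<phi>" for as \<phi>
  proof -
    have "\<exists>x. x \<in> universe A \<and> (sat A as (Ex \<phi>) \<longrightarrow> sat A (x # as) \<phi>)"
      using A by (cases "sat A as (Ex \<phi>)") (auto simp: is_structure_def)
    then have "w (as, \<phi>) \<in> universe A \<and> (sat A as (Ex \<phi>) \<longrightarrow> sat A (w (as, \<phi>) # as) \<phi>)"
      unfolding w_def prod.case by (rule someI_ex)
    then show "w (as, \<phi>) \<in> universe A" "sat A as (Ex \<phi>) \<Longrightarrow> sat A (w (as, \<phi>) # as) \<phi>" by auto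
  qed
  define S where "S = rec_nat {} (\<lambda>_ S. S \<union> w ` (lists S \<times> UNIV))"
  have S: "S 0 = {}" "S (Suc k) = S k \<union> w ` (lists (S k) \<times> UNIV)" for k by (simp_all add: S_def)
  define U where "U = (\<Union>k. S k)"
  have "countable (S k)" for k by (induction k) (auto simp: S intro!: countable_image countable_SIGMA)
  then have countable: "countable U" by (auto simp: U_def)
  have "S k \<subseteq> universe A" for k by (induction k) (auto simp: S w)
  then have sub: "U \<subseteq> universe A" by (auto simp: U_def)
  have mono: "S i \<subseteq> S j" if "i \<le> j" for i j using that by (induction j) (auto simp: S le_Suc_eq)
  have closed: "w (as, \<phi>) \<in> U" if "set as \<subseteq> U" for as \<phi>
  proof -
    have "\<exists>k. set as \<subseteq> S k" using that
    proof (induction as)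
      case (Cons a as)
      then obtain k j where "set as \<subseteq> S k" "a \<in> S j" by (auto simp: U_def)
      then have "set (a # as) \<subseteq> S (max k j)" using mono[of k "max k j"] mono[of j "max k j"] by auto
      then show ?case by blast
    qed simp
    then obtain k where "set as \<subseteq> S k" by blast
    then have "w (as, \<phi>) \<in> S (Suc k)" by (auto simp: S lists_eq_set)
    then show ?thesis by (auto simp: U_def)
  qed
  have fn: "fn A i x \<in> U" if "i < m" "x \<in> U" for i x
  proof -
    let ?\<phi> = "Eq (Var 0) (App i (Var 1))"
    have "sat A [x] (Ex ?\<phi>)" using that sub A by (auto simp: is_structure_def)
    then have "w ([x], ?\<phi>) = fn A i x" using w(2)[of "[x]" ?\<phi>] by simp
    then show ?thesis using closed[of "[x]" ?\<phi>] that by simp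
  qed
  define B where "B = Struct U (fn A)"
  have val: "val B as t = val A as t" for as t by (induction t) (auto simp: B_def)
  have sat: "sat B as \<phi> \<longleftrightarrow> sat A as \<phi>" if "set as \<subseteq> U" for as \<phi>
    using that
  proof (induction \<phi> arbitrary: as)
    case (Ex \<phi>)
    have "sat A as (Ex \<phi>) \<longleftrightarrow> (\<exists>x\<in>U. sat A (x # as) \<phi>)"
      using w(2)[of as \<phi>] closed[OF Ex.prems, of \<phi>] sub by auto
    then show ?case using Ex by (simp add: B_def)
  next
    case (All \<phi>)
    have "sat A as (All \<phi>) \<longleftrightarrow> (\<forall>x\<in>U. sat A (x # as) \<phi>)"
      using w(2)[of as "Neg \<phi>"] closed[OF All.prems, of "Neg \<phi>"] sub by auto
    then show ?case using All by (simp add: B_def)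
  qed (auto simp: val)
  show ?thesis
  proof
    show "is_structure m B" using fn closed[of "[]"] by (auto simp: B_def is_structure_def)
    show "countable (universe B)" using countable by (simp add: B_def)
    show "sat B as \<phi> \<longleftrightarrow> sat A as \<phi>" if "set as \<subseteq> universe B" for as \<phi>
      using sat that by (simp add: B_def)
  qed
qed

lemma sat_Mod_transfer:
  fixes A :: "'a struct"
  assumes E: "\<forall>\<psi>\<in>E. is_formula m 0 \<psi>"
    and A: "A \<in> Mod m E" "\<not> sat A [] \<phi>" and \<phi>: "is_formula m 0 \<phi>"
  shows "\<exists>B \<in> Mod m E :: 'b::infinite struct set. \<not> sat B [] \<phi>"
proof -
  obtain B where B: "is_structure m B" "countable (universe B)"
    "\<And>as \<phi>. set as \<subseteq> universe B \<Longrightarrow> is_formula m (length as) \<phi> \<Longrightarrow> sat B as \<phi> \<longleftrightarrow> sat A as \<phi>"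
    using countable_elementary_substructure[of m A] A by (auto simp: Mod_def)
  obtain f :: "nat \<Rightarrow> 'b" where f: "inj f"
    using infinite_countable_subset[OF infinite_UNIV] by blast
  define h where "h = f \<circ> to_nat_on (universe B)"
  have h: "inj_on h (universe B)"
    unfolding h_def using B(2) f by (meson comp_inj_on inj_on_subset inj_on_to_nat_on subset_UNIV)
  let ?B = "Struct (h ` universe B) (\<lambda>i. h \<circ> fn B i \<circ> inv_into (universe B) h)"
  have sat: "sat ?B [] \<psi> \<longleftrightarrow> sat A [] \<psi>" if "is_formula m 0 \<psi>" for \<psi>
    using sat_image[OF B(1) h, of "[]" \<psi>] B(3)[of "[]" \<psi>] that by simp
  have "is_structure m ?B" using B(1) h by (auto simp: is_structure_def)
  then have "?B \<in> Mod m E" using E A(1) sat by (auto simp: Mod_def)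
  then show ?thesis using sat A(2) \<phi> by blast
qed

lemma theory_of_Mod_type_independent:
  assumes "\<forall>\<psi>\<in>E. is_formula m 0 \<psi>"
  shows "theory_of m (Mod m E :: 'a::infinite struct set) =
    theory_of m (Mod m E :: 'b::infinite struct set)"
proof (intro set_eqI iffI)
  fix \<phi> assume \<phi>: "\<phi> \<in> theory_of m (Mod m E :: 'a struct set)"
  have "sat B [] \<phi>" if B: "B \<in> Mod m E" for B :: "'b struct"
  proof (rule ccontr)
    assume "\<not> sat B [] \<phi>"
    then obtain A :: "'a struct" where "A \<in> Mod m E" "\<not> sat A [] \<phi>"
      using sat_Mod_transfer[OF assms B] \<phi> by (auto simp: theory_of_def)
    with \<phi> show False by (auto simp: theory_of_def)
  qed
  with \<phi> show "\<phi> \<in> theory_of m (Mod m E :: 'b struct set)" by (auto simp: theory_of_def)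
next
  fix \<phi> assume \<phi>: "\<phi> \<in> theory_of m (Mod m E :: 'b struct set)"
  have "sat B [] \<phi>" if B: "B \<in> Mod m E" for B :: "'a struct"
  proof (rule ccontr)
    assume "\<not> sat B [] \<phi>"
    then obtain A :: "'b struct" where "A \<in> Mod m E" "\<not> sat A [] \<phi>"
      using sat_Mod_transfer[OF assms B] \<phi> by (auto simp: theory_of_def)
    with \<phi> show False by (auto simp: theory_of_def)
  qed
  with \<phi> show "\<phi> \<in> theory_of m (Mod m E :: 'a struct set)" by (auto simp: theory_of_def)
qed

end

theory Submission
  imports Defs
begin

text \<open>
  Gaifman's argument, with isomorphism types of balls in place of local formulas. Truth of a
  formula at a tuple depends only on the isomorphism type of a ball of large radius around the
  tuple and on finitely many scattered sentences. In the step for a quantifier, let \<open>R\<close> be the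
  radius of the body and \<open>\<rho> = 2 R + 1\<close>. A witness within \<open>3 \<rho>\<close> of the tuple is moved by the given
  isomorphism. Otherwise adjoin it to a longest \<open>2 \<rho>\<close>-scattered list of points of its type in the
  \<open>\<rho>\<close>-ball of the tuple; the corresponding scattered sentence gives a list in the other structure
  that by maximality has a member outside the \<open>\<rho>\<close>-ball, and this is the required witness.
\<close>

section \<open>Distances and balls\<close>

lemma gaifman_sym: "(x, y) \<in> gaifman m A \<longleftrightarrow> (y, x) \<in> gaifman m A"
  by (auto simp: gaifman_def)

lemma gdist_le_iff: "gdist m A x y \<le> enat k \<longleftrightarrow> (\<exists>j\<le>k. (x, y) \<in> gaifman m A ^^ j)"
proof
  assume "\<exists>j\<le>k. (x, y) \<in> gaifman m A ^^ j"
  then obtain j where j: "j \<le> k" "(x, y) \<in> gaifman m A ^^ j" by blast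
  then have "gdist m A x y \<le> enat j"
    unfolding gdist_def by (intro Inf_lower) auto
  with j show "gdist m A x y \<le> enat k"
    by (meson enat_ord_simps(1) order_trans)
next
  assume "gdist m A x y \<le> enat k"
  \<comment> \<open>The strict form lets \<open>Inf_less_iff\<close> return the length of an actual
    path.\<close>
  then have "gdist m A x y < enat (Suc k)"
    by (metis enat_ord_simps(2) lessI order_le_less_trans)
  then show "\<exists>j\<le>k. (x, y) \<in> gaifman m A ^^ j"
    unfolding gdist_def Inf_less_iff by (auto simp: less_Suc_eq_le)
qed

lemma gdist_refl [simp]: "gdist m A x x = 0"
  using gdist_le_iff[of m A x x 0] by (auto simp: zero_enat_def[symmetric])

lemma gdist_le_0_iff: "gdist m A x y \<le> enat 0 \<longleftrightarrow> x = y"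
  by (simp add: gdist_le_iff)

lemma gdist_sym: "gdist m A x y = gdist m A y x"
proof -
  have "(y, x) \<in> gaifman m A ^^ k" if "(x, y) \<in> gaifman m A ^^ k" for k x y
    using that by (induction k arbitrary: y)
      (auto simp: gaifman_sym[of y] simp del: relpow.simps(2) elim!: relpow_Suc_E
        intro: relpow_Suc_I2 gaifman_sym[THEN iffD1])
  then show ?thesis unfolding gdist_def by metis
qed

lemma gdist_triangle_le:
  assumes "gdist m A x y \<le> enat i" "gdist m A y z \<le> enat j"
  shows "gdist m A x z \<le> enat (i + j)"
proof -
  obtain i' j' where "i' \<le> i" "j' \<le> j"
    "(x, y) \<in> gaifman m A ^^ i'" "(y, z) \<in> gaifman m A ^^ j'"
    using assms by (auto simp: gdist_le_iff)
  then show ?thesis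
    unfolding gdist_le_iff
    by (intro exI[of _ "i' + j'"]) (auto simp: relpow_add)
qed

lemma gdist_edge_le: "(x, y) \<in> gaifman m A \<Longrightarrow> gdist m A x y \<le> enat 1"
  by (auto simp: gdist_le_iff)

text \<open>The last edge of a path is split off, so that an induction on its length can keep the
  starting point fixed.\<close>

lemma gdist_le_Suc_iff:
  "gdist m A x y \<le> enat (Suc k) \<longleftrightarrow>
    gdist m A x y \<le> enat k \<or> (\<exists>z. gdist m A x z \<le> enat k \<and> (z, y) \<in> gaifman m A)"
proof
  assume "gdist m A x y \<le> enat (Suc k)"
  then obtain j where j: "j \<le> Suc k" "(x, y) \<in> gaifman m A ^^ j" by (auto simp: gdist_le_iff)
  then show "gdist m A x y \<le> enat k \<or> (\<exists>z. gdist m A x z \<le> enat k \<and> (z, y) \<in> gaifman m A)"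
    by (cases "j \<le> k") (auto simp: gdist_le_iff le_Suc_eq)
next
  assume "gdist m A x y \<le> enat k \<or> (\<exists>z. gdist m A x z \<le> enat k \<and> (z, y) \<in> gaifman m A)"
  then show "gdist m A x y \<le> enat (Suc k)"
    using gdist_triangle_le[OF _ gdist_edge_le, of m A x _ k y]
    by (auto intro: order_trans)
qed

section \<open>Balls around tuples\<close>

lemma gball_iff:
  "x \<in> gball m A r as \<longleftrightarrow> x \<in> universe A \<and> (\<exists>a\<in>set as. gdist m A a x \<le> enat r)"
  by (auto simp: gball_def)

lemma gball_Cons: "gball m A r (x # as) = gball m A r [x] \<union> gball m A r as"
  by (auto simp: gball_iff)

text \<open>The triangle inequality, in the form used for the bookkeeping of radii: whatever starts
  within \<open>i\<close> of the tuple and travels at most \<open>k\<close> stays in the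
  ball.\<close>

lemma gball_extend:
  assumes "y \<in> gball m A i as" "gdist m A y x \<le> enat k" "i + k \<le> r" "x \<in> universe A"
  shows "x \<in> gball m A r as"
proof -
  obtain a where "a \<in> set as" "gdist m A a y \<le> enat i" using assms(1) by (auto simp: gball_iff)
  moreover from this have "gdist m A a x \<le> enat r"
    using gdist_triangle_le[OF _ assms(2)] assms(3) by (meson enat_ord_simps(1) order_trans)
  ultimately show ?thesis using assms(4) by (auto simp: gball_iff)
qed

lemma gball_mono: "y \<in> gball m A i as \<Longrightarrow> i \<le> r \<Longrightarrow> y \<in> gball m A r as"
  using gball_extend[of y m A i as y 0 r] by (auto simp: gball_iff zero_enat_def[symmetric])

lemma gball_center: "a \<in> set as \<Longrightarrow> set as \<subseteq> universe A \<Longrightarrow> a \<in> gball m A r as"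
  by (auto simp: gball_iff intro!: bexI[of _ a])

section \<open>Isomorphisms of balls\<close>

text \<open>The conclusion of the second condition on a local family, with the isomorphism made an
  explicit argument so that it can be restricted, inverted and glued.\<close>

definition ball_iso ::
  "nat \<Rightarrow> nat \<Rightarrow> 'a struct \<Rightarrow> 'a list \<Rightarrow> 'b struct \<Rightarrow> 'b list \<Rightarrow> ('a \<Rightarrow> 'b) \<Rightarrow> bool" where
  "ball_iso m r A as A' as' h \<longleftrightarrow>
    rel_iso m A (gball m A r as) A' (gball m A' r as') h \<and> map h as = as'"

lemma ball_iso_bij: "ball_iso m r A as A' as' h \<Longrightarrow> bij_betw h (gball m A r as) (gball m A' r as')"
  by (simp add: ball_iso_def rel_iso_def)

lemma ball_iso_fn:
  "ball_iso m r A as A' as' h \<Longrightarrow> i < m \<Longrightarrow> x \<in> gball m A r as \<Longrightarrow> y \<in> gball m A r as \<Longrightarrow>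
    fn A i x = y \<longleftrightarrow> fn A' i (h x) = h y"
  by (simp add: ball_iso_def rel_iso_def)

text \<open>That the tuple lies in the universe puts its entries into the ball, where
  \<open>inv_into\<close> really undoes \<open>h\<close> and so sends \<open>as'\<close> back to
  \<open>as\<close>.\<close>

lemma ball_iso_sym:
  assumes "ball_iso m r A as A' as' h" "set as \<subseteq> universe A"
  shows "ball_iso m r A' as' A as (inv_into (gball m A r as) h)"
proof -
  let ?B = "gball m A r as" and ?B' = "gball m A' r as'"
  let ?g = "inv_into ?B h"
  have bij: "bij_betw h ?B ?B'" and as': "as' = map h as"
    and fn: "\<And>i x y. i < m \<Longrightarrow> x \<in> ?B \<Longrightarrow> y \<in> ?B \<Longrightarrow> fn A i x = y \<longleftrightarrow> fn A' i (h x) = h y"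
    using assms(1) by (auto simp: ball_iso_def rel_iso_def)
  have g: "bij_betw ?g ?B' ?B" using bij by (rule bij_betw_inv_into)
  have hg: "h (?g y) = y" "?g y \<in> ?B" if "y \<in> ?B'" for y
    using that bij g by (auto simp: bij_betw_inv_into_right bij_betwE)
  have "?g (h a) = a" if "a \<in> set as" for a
    using that bij gball_center[OF that assms(2)] by (simp add: bij_betw_inv_into_left)
  then have "map ?g as' = as" unfolding as' by (simp add: map_idI)
  then show ?thesis using g fn hg by (auto simp: ball_iso_def rel_iso_def)
qed

text \<open>A path of length at most \<open>k\<close> that starts within \<open>i\<close> of the
  tuple never leaves the ball of radius \<open>r\<close>, so \<open>h\<close> maps each of its edges
  to an edge. The bound in the other direction comes from the inverse isomorphism.\<close>

lemma ball_iso_gdist_le: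
  assumes h: "ball_iso m r A as A' as' h"
    and "y \<in> gball m A i as" "gdist m A y x \<le> enat k" "i + k \<le> r"
  shows "gdist m A' (h y) (h x) \<le> enat k"
  using assms(3,4)
proof (induction k arbitrary: x)
  case 0
  then show ?case by (simp add: gdist_le_0_iff)
next
  case (Suc k)
  show ?case
  proof (cases "gdist m A y x \<le> enat k")
    case True
    then show ?thesis using Suc by (auto simp: gdist_le_Suc_iff)
  next
    case False
    then obtain z where z: "gdist m A y z \<le> enat k" "(z, x) \<in> gaifman m A"
      using Suc.prems(1) by (auto simp: gdist_le_Suc_iff)
    then have "z \<in> universe A" "x \<in> universe A" by (auto simp: gaifman_def)
    then have zx: "z \<in> gball m A r as" "x \<in> gball m A r as"
      using gball_extend[OF assms(2) z(1)] gball_extend[OF assms(2) Suc.prems(1)] Suc.prems(2)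
      by auto
    then have "h z \<in> gball m A' r as'" "h x \<in> gball m A' r as'"
      using ball_iso_bij[OF h] by (auto simp: bij_betwE)
    then have "h z \<in> universe A'" "h x \<in> universe A'" by (auto simp: gball_iff)
    then have "(h z, h x) \<in> gaifman m A'"
      using ball_iso_fn[OF h _ zx] ball_iso_fn[OF h _ zx(2,1)] z(2) unfolding gaifman_def by blast
    then show ?thesis using Suc.IH[OF z(1)] Suc.prems(2) by (auto simp: gdist_le_Suc_iff)
  qed
qed

text \<open>Centres go to centres, and distances from them do not grow.\<close>

lemma ball_iso_gball:
  assumes h: "ball_iso m r A as A' as' h" and "set as \<subseteq> universe A" "x \<in> gball m A i as" "i \<le> r"
  shows "h x \<in> gball m A' i as'"
proof -
  obtain a where a: "a \<in> set as" "gdist m A a x \<le> enat i" using assms(3) by (auto simp: gball_iff)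
  have "a \<in> gball m A 0 as" using a assms(2) by (auto intro: gball_center)
  then have "gdist m A' (h a) (h x) \<le> enat i"
    using ball_iso_gdist_le[OF h _ a(2)] assms(4) by simp
  moreover have "h a \<in> set as'" using h a by (auto simp: ball_iso_def)
  moreover have "h x \<in> universe A'"
    using bij_betwE[OF ball_iso_bij[OF h]] gball_mono[OF assms(3,4)] by (simp add: gball_iff)
  ultimately show ?thesis by (auto simp: gball_iff)
qed

text \<open>By the distance bound \<open>h\<close> sends the smaller ball into the ball around the
  image tuple; the same bound for the inverse of \<open>h\<close> shows that this image is
  everything.\<close>

lemma ball_iso_restrict:
  assumes h: "ball_iso m r A as A' as' h" and as: "set as \<subseteq> universe A"
    and as': "set as' \<subseteq> universe A'"
    and bs: "set bs \<subseteq> gball m A i as" and ik: "i + k \<le> r"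
  shows "ball_iso m k A bs A' (map h bs) h"
proof -
  let ?B = "gball m A r as"
  let ?g = "inv_into ?B h"
  have bij: "bij_betw h ?B (gball m A' r as')" using h by (auto simp: ball_iso_def rel_iso_def)
  have g: "ball_iso m r A' as' A as ?g" using ball_iso_sym[OF h as] .
  have sub: "gball m A k bs \<subseteq> ?B"
    using bs gball_extend[OF _ _ ik] by (fastforce simp: gball_iff)
  have "h ` gball m A k bs = gball m A' k (map h bs)"
  proof (intro equalityI subsetI)
    fix y assume "y \<in> h ` gball m A k bs"
    then obtain x where x: "y = h x" "x \<in> gball m A k bs" by blast
    then obtain b where b: "b \<in> set bs" "gdist m A b x \<le> enat k" by (auto simp: gball_iff)
    then have "gdist m A' (h b) (h x) \<le> enat k"
      using ball_iso_gdist_le[OF h _ _ ik] bs by blast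
    moreover have "h x \<in> universe A'"
      using x(2) sub bij_betwE[OF bij] by (metis gball_iff subsetD)
    ultimately show "y \<in> gball m A' k (map h bs)" using x b by (auto simp: gball_iff)
  next
    fix y assume "y \<in> gball m A' k (map h bs)"
    then obtain b where b: "b \<in> set bs" "gdist m A' (h b) y \<le> enat k" and y: "y \<in> universe A'"
      by (auto simp: gball_iff)
    have hb: "h b \<in> gball m A' i as'" using ball_iso_gball[OF h as] b bs ik by auto
    have "y \<in> gball m A' r as'" using gball_extend[OF hb b(2) ik y] .
    then have gy: "h (?g y) = y" "?g y \<in> ?B"
      using bij bij_betw_inv_into[OF bij] by (auto simp: bij_betw_inv_into_right bij_betwE)
    have "b \<in> ?B" using b bs ik gball_mono[of b m A i as r] by auto
    then have "?g (h b) = b" using bij by (simp add: bij_betw_inv_into_left)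
    then have "gdist m A b (?g y) \<le> enat k"
      using ball_iso_gdist_le[OF g hb b(2) ik] by simp
    then have "?g y \<in> gball m A k bs" using b gy by (auto simp: gball_iff)
    then show "y \<in> h ` gball m A k bs" using gy by force
  qed
  then have "bij_betw h (gball m A k bs) (gball m A' k (map h bs))"
    using bij_betw_subset[OF bij sub] by simp
  then show ?thesis using h sub by (auto simp: ball_iso_def rel_iso_def)
qed

section \<open>Composing and gluing isomorphisms\<close>

lemma ball_iso_trans:
  assumes "ball_iso m r A as A' as' h" "ball_iso m r A' as' A'' as'' h'"
  shows "ball_iso m r A as A'' as'' (h' \<circ> h)"
  using assms unfolding ball_iso_def rel_iso_def
  by (auto intro: bij_betw_trans simp: bij_betwE)

text \<open>A common point or an edge between the two balls would give a path of length at most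
  \<open>r + 1 + r\<close> between the centres. This is the origin of the constant
  \<open>2 * r + 1\<close>.\<close>

lemma far_balls_apart:
  assumes far: "\<forall>a\<in>set as. \<not> gdist m A a x \<le> enat (2 * r + 1)"
    and u: "u \<in> gball m A r [x]" and v: "v \<in> gball m A r as"
  shows "u \<noteq> v" "i < m \<Longrightarrow> fn A i u \<noteq> v" "i < m \<Longrightarrow> fn A i v \<noteq> u"
proof -
  obtain a where a: "a \<in> set as" "gdist m A a v \<le> enat r" using v by (auto simp: gball_iff)
  have ux: "gdist m A u x \<le> enat r" using u by (auto simp: gball_iff gdist_sym)
  have n: "\<not> gdist m A v u \<le> enat 1"
  proof
    assume "gdist m A v u \<le> enat 1"
    then have "gdist m A a x \<le> enat (2 * r + 1)"
      using gdist_triangle_le[OF gdist_triangle_le[OF a(2)] ux, of 1] by (simp add: mult_2)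
    then show False using far a(1) by blast
  qed
  then show "u \<noteq> v" by auto
  have "(v, u) \<notin> gaifman m A" using n gdist_edge_le[of v u m A] by auto
  then show "i < m \<Longrightarrow> fn A i u \<noteq> v" "i < m \<Longrightarrow> fn A i v \<noteq> u" using u v by (auto simp: gaifman_def gball_iff)
qed

text \<open>In both structures the two balls are disjoint and joined by no edge, so the union of the
  two isomorphisms is again one.\<close>

lemma ball_iso_Cons:
  assumes h1: "ball_iso m r A [x] A' [x'] h1" and h2: "ball_iso m r A as A' as' h2"
    and as: "set as \<subseteq> universe A" and x: "x \<in> universe A"
    and far: "\<forall>a\<in>set as. \<not> gdist m A a x \<le> enat (2 * r + 1)"
      "\<forall>a\<in>set as'. \<not> gdist m A' a x' \<le> enat (2 * r + 1)"
  shows "\<exists>h. ball_iso m r A (x # as) A' (x' # as') h"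
proof -
  let ?X = "gball m A r [x]" and ?Y = "gball m A r as"
  let ?X' = "gball m A' r [x']" and ?Y' = "gball m A' r as'"
  define h where "h = (\<lambda>u. if u \<in> ?X then h1 u else h2 u)"
  have disj: "?X \<inter> ?Y = {}" "?X' \<inter> ?Y' = {}"
    using far_balls_apart(1)[OF far(1)] far_balls_apart(1)[OF far(2)] by blast+
  have hX: "h u = h1 u" if "u \<in> ?X" for u using that by (simp add: h_def)
  have hY: "h u = h2 u" if "u \<in> ?Y" for u using that disj by (auto simp: h_def)
  have b1: "bij_betw h1 ?X ?X'" and b2: "bij_betw h2 ?Y ?Y'"
    using h1 h2 by (auto simp: ball_iso_def rel_iso_def)
  then have bX: "bij_betw h ?X ?X'" and bY: "bij_betw h ?Y ?Y'"
    using hX hY by (simp_all cong: bij_betw_cong)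
  have "bij_betw h (?X \<union> ?Y) (?X' \<union> ?Y')"
    using bij_betw_combine[OF bX bY disj(2)] .
  moreover have "fn A i u = v \<longleftrightarrow> fn A' i (h u) = h v"
    if i: "i < m" and uv: "u \<in> ?X \<union> ?Y" "v \<in> ?X \<union> ?Y" for i u v
  proof -
    consider "u \<in> ?X" "v \<in> ?X" | "u \<in> ?Y" "v \<in> ?Y" | "u \<in> ?X" "v \<in> ?Y" | "u \<in> ?Y" "v \<in> ?X"
      using uv by blast
    then show ?thesis
    proof cases
      case 1
      then show ?thesis using ball_iso_fn[OF h1 i 1] by (simp add: hX)
    next
      case 2
      then show ?thesis using ball_iso_fn[OF h2 i 2] by (simp add: hY)
    next
      \<comment> \<open>In the mixed cases both sides of the equivalence are false.\<close>
      case 3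
      then have "h u \<in> ?X'" "h v \<in> ?Y'" using bX bY by (auto simp: bij_betwE)
      then show ?thesis
        using far_balls_apart(2)[OF far(1) 3 i] far_balls_apart(2)[OF far(2) _ _ i]
        by blast
    next
      case 4
      then have "h u \<in> ?Y'" "h v \<in> ?X'" using bX bY by (auto simp: bij_betwE)
      then show ?thesis
        using far_balls_apart(3)[OF far(1) 4(2,1) i]
          far_balls_apart(3)[OF far(2) _ _ i]
        by blast
    qed
  qed
  moreover have "map h (x # as) = x' # as'"
  proof -
    have "h x = x'" using h1 x gball_center[of x "[x]" A m r] by (simp add: hX ball_iso_def)
    moreover have "map h as = as'"
      using h2 as gball_center[of _ as A m r] by (auto simp: hY ball_iso_def)
    ultimately show ?thesis by simp
  qed
  ultimately have "ball_iso m r A (x # as) A' (x' # as') h"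
    unfolding ball_iso_def rel_iso_def gball_Cons[of m A r x as] gball_Cons[of m A' r x' as']
    by blast
  then show ?thesis by blast
qed

text \<open>Each function application moves along at most one step of the Gaifman graph, so
  \<open>size t\<close> bounds the distance of the value from the tuple, and evaluation never leaves
  the domain of \<open>h\<close>.\<close>

lemma ball_iso_val:
  assumes h: "ball_iso m r A as A' as' h" and A: "is_structure m A" "set as \<subseteq> universe A"
    and A': "is_structure m A'" "set as' \<subseteq> universe A'"
    and t: "is_term m (length as) t" "size t \<le> r"
  shows "val A as t \<in> gball m A (size t) as \<and> h (val A as t) = val A' as' t"
  using t
proof (induction t)
  case (Var k)
  then show ?case using h A(2) by (auto simp: ball_iso_def intro: gball_center)
next
  case (App i t)
  let ?x = "val A as t"
  have len: "length as' = length as" using h by (auto simp: ball_iso_def)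
  have IH: "?x \<in> gball m A (size t) as" "h ?x = val A' as' t" using App by auto
  have i: "i < m" "size t + 1 \<le> r" using App.prems by auto
  have x: "?x \<in> universe A" using IH(1) by (simp add: gball_iff)
  then have fx: "fn A i ?x \<in> universe A" using A i by (auto simp: is_structure_def)
  then have "(?x, fn A i ?x) \<in> gaifman m A" using i x by (auto simp: gaifman_def)
  then have d: "gdist m A ?x (fn A i ?x) \<le> enat 1" by (rule gdist_edge_le)
  then have fb: "fn A i ?x \<in> gball m A (size (App i t)) as"
    using gball_extend[OF IH(1) d _ fx] by simp
  have "fn A i ?x \<in> gball m A r as" using gball_extend[OF IH(1) d i(2) fx] .
  moreover have "?x \<in> gball m A r as" using gball_mono[OF IH(1)] i by simp
  ultimately have "fn A' i (h ?x) = h (fn A i ?x)"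
    using h i(1) by (auto simp: ball_iso_def rel_iso_def)
  then show ?case using fb IH(2) by simp
qed

section \<open>Extending isomorphisms by one point\<close>

definition scattered :: "nat \<Rightarrow> nat \<Rightarrow> 'a struct \<Rightarrow> 'a list \<Rightarrow> bool" where
  "scattered m r A vs \<longleftrightarrow>
    (\<forall>j<length vs. \<forall>i<j. gdist m A (vs ! i) (vs ! j) > enat (2 * r))"

lemma scattered_snoc:
  assumes "scattered m r A vs" "\<forall>v\<in>set vs. gdist m A v x > enat (2 * r)"
  shows "scattered m r A (vs @ [x])"
  using assms by (auto simp: scattered_def nth_append less_Suc_eq)

text \<open>Pigeonhole principle: two entries within \<open>r\<close> of the same centre would be at
  distance at most \<open>2 * r\<close>.\<close>

lemma length_scattered_le:
  assumes "scattered m r A vs" "set vs \<subseteq> gball m A r as"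
  shows "length vs \<le> length as"
proof -
  have "\<exists>a\<in>set as. gdist m A a v \<le> enat r" if "v \<in> set vs" for v
    using assms(2) that by (auto simp: gball_iff)
  then obtain f where f: "\<And>v. v \<in> set vs \<Longrightarrow> f v \<in> set as \<and> gdist m A (f v) v \<le> enat r"
    by metis
  have far: "f (vs ! i) \<noteq> f (vs ! j)" if "i < j" "j < length vs" for i j
  proof
    assume eq: "f (vs ! i) = f (vs ! j)"
    have "gdist m A (vs ! i) (f (vs ! j)) \<le> enat r" "gdist m A (f (vs ! j)) (vs ! j) \<le> enat r"
      using f[of "vs ! i"] f[of "vs ! j"] that eq by (auto simp: gdist_sym)
    from gdist_triangle_le[OF this] show False
      using assms(1) that unfolding scattered_def mult_2 by (meson leD)
  qed
  then have "distinct (map f vs)"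
    by (auto simp: distinct_conv_nth) (metis nat_neq_iff)
  then have "length vs = card (set (map f vs))" using distinct_card[of "map f vs"] by simp
  also have "\<dots> \<le> card (set as)" using f by (intro card_mono) auto
  also have "\<dots> \<le> length as" by (rule card_length)
  finally show ?thesis .
qed

text \<open>The image \<open>h x\<close> serves as \<open>x'\<close>, and \<open>h\<close>
  restricted to radius \<open>k\<close> is the required isomorphism.\<close>

lemma ball_iso_extend_near:
  assumes h: "ball_iso m r A as A' as' h"
    and as: "set as \<subseteq> universe A" and as': "set as' \<subseteq> universe A'"
    and x: "x \<in> gball m A i as" and i: "i + k \<le> r"
  shows "\<exists>x'\<in>universe A'. \<exists>h'. ball_iso m k A (x # as) A' (x' # as') h'"
proof -
  have "set (x # as) \<subseteq> gball m A i as" using x as by (auto intro: gball_center)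
  then have "ball_iso m k A (x # as) A' (map h (x # as)) h"
    using ball_iso_restrict[OF h as as' _ i] by blast
  moreover have "map h as = as'" using h by (simp add: ball_iso_def)
  moreover have "h x \<in> universe A'"
    using ball_iso_gball[OF h as x] i by (simp add: gball_iff)
  ultimately show ?thesis by auto
qed

text \<open>The outer radius \<open>4 * \<rho>\<close> leaves room for a point within
  \<open>3 * \<rho>\<close> together with its \<open>r\<close>-ball, and for paths of length
  \<open>2 * \<rho>\<close> that start within \<open>\<rho>\<close>. The bound
  \<open>Suc (length as)\<close> in \<open>transfer\<close> allows for a scattered list inside the
  \<open>\<rho>\<close>-ball and one further point.\<close>

lemma ball_iso_extend:
  fixes r :: nat and as :: "'a list" and as' :: "'b list"
  defines "\<rho> \<equiv> 2 * r + 1"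
  assumes h: "ball_iso m (4 * \<rho>) A as A' as' h"
    and as: "set as \<subseteq> universe A" and as': "set as' \<subseteq> universe A'" and x: "x \<in> universe A"
    and transfer: "\<And>vs. vs \<noteq> [] \<Longrightarrow> length vs \<le> Suc (length as) \<Longrightarrow> set vs \<subseteq> universe A \<Longrightarrow>
      scattered m \<rho> A vs \<Longrightarrow> \<exists>vs'. length vs' = length vs \<and> set vs' \<subseteq> universe A' \<and>
        scattered m \<rho> A' vs' \<and> (\<forall>i<length vs. \<exists>g. ball_iso m \<rho> A [vs ! i] A' [vs' ! i] g)"
  shows "\<exists>x'\<in>universe A'. \<exists>h'. ball_iso m r A (x # as) A' (x' # as') h'"
proof (cases "x \<in> gball m A (3 * \<rho>) as")
  case True
  then show ?thesis by (rule ball_iso_extend_near[OF h as as']) (simp add: \<rho>_def)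
next
  case far: False
  let ?B = "gball m A (4 * \<rho>) as"
  let ?g = "inv_into ?B h"
  have g: "ball_iso m (4 * \<rho>) A' as' A as ?g" using ball_iso_sym[OF h as] .
  \<comment> \<open>Only radius \<open>r\<close> matters here, since this is the radius at which the
    new point is finally glued to the tuple.\<close>
  define same where "same = (\<lambda>v. \<exists>g. ball_iso m r A [x] A [v] g)"
  define P where "P = (\<lambda>vs. set vs \<subseteq> gball m A \<rho> as \<and> (\<forall>v\<in>set vs. same v) \<and> scattered m \<rho> A vs)"
  have bound: "\<forall>vs. P vs \<longrightarrow> length vs < Suc (length as)"
    using length_scattered_le by (auto simp: P_def less_Suc_eq_le)
  have "P []" by (auto simp: P_def scattered_def)
  \<comment> \<open>The empty list satisfies \<open>P\<close> and lengths are bounded, so a longest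
    list exists; it may be empty, in which case \<open>[x]\<close> alone is transferred.\<close>
  from ex_has_greatest_nat[where P = P and f = length, OF this bound]
  obtain vs where vs: "P vs" and max: "\<And>ws. P ws \<Longrightarrow> length ws \<le> length vs"
    by (elim exE conjE) (rule that, auto)
  \<comment> \<open>A member of \<open>vs\<close> is within \<open>\<rho>\<close> of the tuple;
    being within \<open>2 * \<rho>\<close> of \<open>x\<close> as well, it would bring
    \<open>x\<close> into the excluded ball of radius \<open>3 * \<rho>\<close>.\<close>
  have "gdist m A v x > enat (2 * \<rho>)" if "v \<in> set vs" for v
  proof (rule ccontr)
    assume "\<not> ?thesis"
    moreover have "v \<in> gball m A \<rho> as" using vs that by (auto simp: P_def)
    ultimately have "x \<in> gball m A (3 * \<rho>) as"
      using gball_extend[of v m A \<rho> as x "2 * \<rho>" "3 * \<rho>"] x by (simp add: not_less)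
    with far show False ..
  qed
  then have "scattered m \<rho> A (vs @ [x])" using vs by (auto simp: P_def intro: scattered_snoc)
  moreover have "length (vs @ [x]) \<le> Suc (length as)" using bound[rule_format, OF vs] by simp
  moreover have "set (vs @ [x]) \<subseteq> universe A" using vs x by (auto simp: P_def gball_iff)
  ultimately obtain vs' where vs': "length vs' = Suc (length vs)" "set vs' \<subseteq> universe A'"
      "scattered m \<rho> A' vs'"
    and iso: "\<And>i. i < Suc (length vs) \<Longrightarrow> \<exists>g. ball_iso m \<rho> A [(vs @ [x]) ! i] A' [vs' ! i] g"
    using transfer[of "vs @ [x]"] by auto
  \<comment> \<open>Each \<open>v'\<close> resembles a member of \<open>vs @ [x]\<close> at radius
    \<open>\<rho>\<close>, hence at radius \<open>r\<close>, and every such member resembles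
    \<open>x\<close>.\<close>
  have same': "\<exists>g. ball_iso m r A [x] A' [v'] g" if v': "v' \<in> set vs'" for v'
  proof -
    obtain i where i: "i < Suc (length vs)" "v' = vs' ! i" using v' vs'(1) by (metis in_set_conv_nth)
    define v where "v = (vs @ [x]) ! i"
    have v: "v \<in> set (vs @ [x])" unfolding v_def using i by (metis length_append_singleton nth_mem)
    then have vA: "v \<in> universe A" using vs x by (auto simp: P_def gball_iff)
    have "ball_iso m r A [x] A [x] id" by (simp add: ball_iso_def rel_iso_def bij_betw_id)
    then have "same v" using vs v by (auto simp: P_def same_def)
    moreover obtain g' where g': "ball_iso m \<rho> A [v] A' [v'] g'" using iso[OF i(1)] i(2) by (auto simp: v_def)
    moreover have "ball_iso m r A [v] A' (map g' [v]) g'"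
      using vA v' vs'(2) by (intro ball_iso_restrict[OF g', where i = 0] subsetI gball_center) (auto simp: \<rho>_def)
    moreover have "map g' [v] = [v']" using g' by (simp add: ball_iso_def)
    ultimately show ?thesis unfolding same_def using ball_iso_trans by metis
  qed
  \<comment> \<open>Otherwise pulling \<open>vs'\<close> back along the inverse of \<open>h\<close>
    would give a list with property \<open>P\<close> that is longer than \<open>vs\<close> by one
    entry.\<close>
  have "\<not> set vs' \<subseteq> gball m A' \<rho> as'"
  proof
    assume near: "set vs' \<subseteq> gball m A' \<rho> as'"
    have hg: "h (?g v') = v'" if "v' \<in> set vs'" for v'
    proof -
      have "v' \<in> gball m A' (4 * \<rho>) as'" using near that gball_mono[of v' m A' \<rho> as'] by auto
      then show ?thesis using bij_betw_inv_into_right[OF ball_iso_bij[OF h]] by blast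
    qed
    have gb: "?g v' \<in> gball m A \<rho> as" if "v' \<in> set vs'" for v'
      using ball_iso_gball[OF g as'] near that by auto
    have "P (map ?g vs')"
      unfolding P_def
    proof (intro conjI ballI)
      show "set (map ?g vs') \<subseteq> gball m A \<rho> as" using gb by auto
      show "same v" if v: "v \<in> set (map ?g vs')" for v
      proof -
        obtain v' where v': "v' \<in> set vs'" "v = ?g v'" using v by auto
        have "ball_iso m r A' [v'] A (map ?g [v']) ?g"
          using near v' by (intro ball_iso_restrict[OF g as' as, where i = \<rho>]) (auto simp: \<rho>_def)
        then show ?thesis unfolding same_def using same'[OF v'(1)] ball_iso_trans v'(2) by fastforce
      qed
      show "scattered m \<rho> A (map ?g vs')"
        unfolding scattered_def
      proof (intro allI impI)
        fix i j assume "j < length (map ?g vs')" "i < j"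
        then have ij: "i < length vs'" "j < length vs'" "i < j" by auto
        show "enat (2 * \<rho>) < gdist m A (map ?g vs' ! i) (map ?g vs' ! j)"
        proof (rule ccontr)
          assume "\<not> ?thesis"
          then have "gdist m A (?g (vs' ! i)) (?g (vs' ! j)) \<le> enat (2 * \<rho>)" using ij by (simp add: not_less)
          \<comment> \<open>Since \<open>\<rho> + 2 * \<rho> \<le> 4 * \<rho>\<close>, a short path
            between the pulled back points lies in the domain of \<open>h\<close> and would bring
            the original points too close.\<close>
          then have "gdist m A' (h (?g (vs' ! i))) (h (?g (vs' ! j))) \<le> enat (2 * \<rho>)"
            using gb ij by (intro ball_iso_gdist_le[OF h, where i = \<rho>]) auto
          moreover have "enat (2 * \<rho>) < gdist m A' (vs' ! i) (vs' ! j)"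
            using vs'(3) ij unfolding scattered_def by blast
          ultimately show False using hg[of "vs' ! i"] hg[of "vs' ! j"] ij by (simp add: leD)
        qed
      qed
    qed
    then show False using max[of "map ?g vs'"] vs'(1) by simp
  qed
  then obtain x' where x': "x' \<in> set vs'" "x' \<notin> gball m A' \<rho> as'" by blast
  then have x'A: "x' \<in> universe A'" using vs'(2) by blast
  obtain h1 where h1: "ball_iso m r A [x] A' [x'] h1" using same'[OF x'(1)] by blast
  have "ball_iso m r A as A' (map h as) h"
    using as by (intro ball_iso_restrict[OF h as as', where i = 0] subsetI gball_center) (auto simp: \<rho>_def)
  then have h2: "ball_iso m r A as A' as' h" using h by (simp add: ball_iso_def)
  \<comment> \<open>Lying outside the \<open>\<rho>\<close>-ball means distance above
    \<open>2 * r + 1\<close> from every centre, in both structures: exactly the gap that gluing at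
    radius \<open>r\<close> demands.\<close>
  have "x \<notin> gball m A \<rho> as" using far gball_mono[of x m A \<rho> as "3 * \<rho>"] by auto
  then have "\<forall>a\<in>set as. \<not> gdist m A a x \<le> enat (2 * r + 1)"
    "\<forall>a\<in>set as'. \<not> gdist m A' a x' \<le> enat (2 * r + 1)"
    using x x' x'A by (auto simp: gball_iff \<rho>_def)
  from ball_iso_Cons[OF h1 h2 as x this] show ?thesis using x'A by blast
qed

section \<open>Locality of first-order formulas\<close>

definition agree :: "fm set \<Rightarrow> 'a struct \<Rightarrow> 'b struct \<Rightarrow> bool" where
  "agree \<Sigma> A A' \<longleftrightarrow> (\<forall>\<sigma>\<in>\<Sigma>. sat A [] \<sigma> \<longleftrightarrow> sat A' [] \<sigma>)"

text \<open>The invariant of the induction on formulas. The length of \<open>as'\<close> comes from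
  the condition \<open>map h as = as'\<close> in \<open>ball_iso\<close>.\<close>

definition determined_by :: "nat \<Rightarrow> 'a struct set \<Rightarrow> nat \<Rightarrow> fm set \<Rightarrow> nat \<Rightarrow> fm \<Rightarrow> bool" where
  "determined_by m V r \<Sigma> n \<phi> \<longleftrightarrow> (\<forall>A\<in>V. \<forall>A'\<in>V. \<forall>as as' h.
     length as = n \<and> set as \<subseteq> universe A \<and> set as' \<subseteq> universe A' \<and>
     agree \<Sigma> A A' \<and> ball_iso m r A as A' as' h \<longrightarrow> (sat A as \<phi> \<longleftrightarrow> sat A' as' \<phi>))"

lemma determined_byD:
  "determined_by m V r \<Sigma> n \<phi> \<Longrightarrow> A \<in> V \<Longrightarrow> A' \<in> V \<Longrightarrow> length as = n \<Longrightarrow>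
    set as \<subseteq> universe A \<Longrightarrow> set as' \<subseteq> universe A' \<Longrightarrow> agree \<Sigma> A A' \<Longrightarrow>
    ball_iso m r A as A' as' h \<Longrightarrow> sat A as \<phi> \<longleftrightarrow> sat A' as' \<phi>"
  unfolding determined_by_def by blast

lemma ball_iso_radius_mono:
  assumes h: "ball_iso m r A as A' as' h" and "set as \<subseteq> universe A" "set as' \<subseteq> universe A'"
    and "k \<le> r"
  shows "ball_iso m k A as A' as' h"
proof -
  have "ball_iso m k A as A' (map h as) h"
    using assms by (intro ball_iso_restrict[OF h, where i = 0] subsetI gball_center) auto
  then show ?thesis using h by (simp add: ball_iso_def)
qed

lemma determined_by_mono:
  assumes "determined_by m V r \<Sigma> n \<phi>" "r \<le> r'" "\<Sigma> \<subseteq> \<Sigma>'"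
  shows "determined_by m V r' \<Sigma>' n \<phi>"
  unfolding determined_by_def
proof (intro ballI allI impI, elim conjE)
  fix A A' as as' h
  assume *: "A \<in> V" "A' \<in> V" "length as = n" "set as \<subseteq> universe A" "set as' \<subseteq> universe A'"
    "agree \<Sigma>' A A'" "ball_iso m r' A as A' as' h"
  have "ball_iso m r A as A' as' h" "agree \<Sigma> A A'"
    using ball_iso_radius_mono[OF *(7,4,5) assms(2)] *(6) assms(3) by (auto simp: agree_def)
  with * assms(1) show "sat A as \<phi> \<longleftrightarrow> sat A' as' \<phi>" unfolding determined_by_def by blast
qed

section \<open>Connectives and equations\<close>

text \<open>Stated for any semantic negation \<open>\<psi>\<close>, so that it also passes from
  \<open>Ex (Neg \<phi>)\<close> to \<open>All \<phi>\<close>.\<close>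

lemma determined_by_not:
  fixes V :: "'a struct set"
  assumes "determined_by m V r \<Sigma> n \<phi>"
    and "\<And>(A :: 'a struct) as. sat A as \<psi> \<longleftrightarrow> \<not> sat A as \<phi>"
  shows "determined_by m V r \<Sigma> n \<psi>"
  using assms by (simp add: determined_by_def)

lemma determined_by_binary:
  fixes V :: "'a struct set"
  assumes "determined_by m V r \<Sigma> n \<phi>" "determined_by m V r \<Sigma> n \<psi>"
    and "\<And>(A :: 'a struct) as. sat A as \<chi> \<longleftrightarrow> f (sat A as \<phi>) (sat A as \<psi>)"
  shows "determined_by m V r \<Sigma> n \<chi>"
  unfolding determined_by_def
proof (intro ballI allI impI)
  fix A A' as as' h
  assume *: "A \<in> V" "A' \<in> V" "length as = n \<and> set as \<subseteq> universe A \<and> set as' \<subseteq> universe A' \<and>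
    agree \<Sigma> A A' \<and> ball_iso m r A as A' as' h"
  have "sat A as \<phi> \<longleftrightarrow> sat A' as' \<phi>" "sat A as \<psi> \<longleftrightarrow> sat A' as' \<psi>"
    using assms(1,2) * unfolding determined_by_def by blast+
  then show "sat A as \<chi> \<longleftrightarrow> sat A' as' \<chi>" by (simp add: assms(3))
qed

text \<open>Both values lie in the ball, where \<open>h\<close> is injective and commutes with
  evaluation.\<close>

lemma determined_by_Eq:
  assumes V: "\<forall>A\<in>V. is_structure m A" and st: "is_term m n s" "is_term m n t"
  shows "determined_by m V (max (size s) (size t)) {} n (Eq s t)"
  unfolding determined_by_def
proof (intro ballI allI impI, elim conjE)
  fix A A' as as' h
  assume *: "A \<in> V" "A' \<in> V" "length as = n" "set as \<subseteq> universe A" "set as' \<subseteq> universe A'"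
    and h: "ball_iso m (max (size s) (size t)) A as A' as' h"
  let ?B = "gball m A (max (size s) (size t)) as"
  have v: "val A as u \<in> ?B \<and> h (val A as u) = val A' as' u" if "u = s \<or> u = t" for u
  proof -
    have "val A as u \<in> gball m A (size u) as \<and> h (val A as u) = val A' as' u"
      using that * V st by (intro ball_iso_val[OF h]) auto
    then show ?thesis using that gball_mono[of "val A as u" m A "size u" as] by auto
  qed
  have "inj_on h ?B" using ball_iso_bij[OF h] by (simp add: bij_betw_def)
  then show "sat A as (Eq s t) \<longleftrightarrow> sat A' as' (Eq s t)"
    using v[of s] v[of t] inj_on_eq_iff[of h ?B "val A as s" "val A as t"] by simp
qed

section \<open>Local families and the quantifier step\<close>

lemma local_family_finite: "local_family m V C \<Longrightarrow> finite (C r n)"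
  and local_family_formula: "local_family m V C \<Longrightarrow> \<alpha> \<in> C r n \<Longrightarrow> is_formula m n \<alpha>"
  by (simp_all add: local_family_def)

lemma local_family_ex:
  assumes C: "local_family m V C" and "A \<in> V" "length as = n" "set as \<subseteq> universe A"
  shows "\<exists>\<alpha>\<in>C r n. sat A as \<alpha>"
proof -
  note * = C[unfolded local_family_def, THEN spec[of _ r], THEN spec[of _ n]]
  have "\<exists>!\<alpha>. \<alpha> \<in> C r n \<and> sat A as \<alpha>"
    using *[THEN conjunct2, THEN conjunct2, THEN conjunct1] assms(2-) by simp
  then show ?thesis by blast
qed

lemma local_family_ball_iso:
  assumes C: "local_family m V C" and "A \<in> V" "A' \<in> V" "\<alpha> \<in> C r n"
    and "length as = n" "length as' = n" "set as \<subseteq> universe A" "set as' \<subseteq> universe A'"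
    and "sat A as \<alpha>" "sat A' as' \<alpha>"
  shows "\<exists>h. ball_iso m r A as A' as' h"
proof -
  note * = C[unfolded local_family_def, THEN spec[of _ r], THEN spec[of _ n]]
  show ?thesis
    using *[THEN conjunct2, THEN conjunct2, THEN conjunct2] assms(2-) unfolding ball_iso_def by blast
qed

text \<open>Supplies the hypothesis \<open>transfer\<close> of \<open>ball_iso_extend\<close>.
  Listing the local formula of each point gives a scattered sentence true in \<open>A\<close>, hence
  in \<open>A'\<close>; points sharing a local formula have isomorphic balls.\<close>

lemma scattered_transfer:
  assumes C: "local_family m V C" and A: "A \<in> V" "A' \<in> V"
    and agree: "agree {scattered_sentence m r \<alpha>s |\<alpha>s.
      set \<alpha>s \<subseteq> C r 1 \<and> length \<alpha>s \<le> k \<and> \<alpha>s \<noteq> []} A A'"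
    and vs: "vs \<noteq> []" "length vs \<le> k" "set vs \<subseteq> universe A" "scattered m r A vs"
  shows "\<exists>vs'. length vs' = length vs \<and> set vs' \<subseteq> universe A' \<and>
    scattered m r A' vs' \<and> (\<forall>i<length vs. \<exists>g. ball_iso m r A [vs ! i] A' [vs' ! i] g)"
proof -
  have "\<exists>\<alpha>\<in>C r 1. sat A [v] \<alpha>" if "v \<in> set vs" for v
    using local_family_ex[OF C A(1), of "[v]" 1] that vs(3) by auto
  then obtain f where f: "\<And>v. v \<in> set vs \<Longrightarrow> f v \<in> C r 1 \<and> sat A [v] (f v)" by metis
  let ?\<alpha>s = "map f vs"
  have fm: "\<forall>\<alpha>\<in>set ?\<alpha>s. is_formula m 1 \<alpha>" using f local_family_formula[OF C, of _ r 1] by auto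
  have "sat A [] (scattered_sentence m r ?\<alpha>s)"
    unfolding sat_scattered_sentence[OF fm]
    using vs f by (intro exI[of _ vs]) (auto simp: scattered_def)
  moreover have "scattered_sentence m r ?\<alpha>s \<in> {scattered_sentence m r \<alpha>s |\<alpha>s.
      set \<alpha>s \<subseteq> C r 1 \<and> length \<alpha>s \<le> k \<and> \<alpha>s \<noteq> []}"
    using f vs by (intro CollectI exI[of _ ?\<alpha>s]) auto
  ultimately have "sat A' [] (scattered_sentence m r ?\<alpha>s)" using agree unfolding agree_def by blast
  then obtain vs' where vs': "length vs' = length vs" "set vs' \<subseteq> universe A'" "scattered m r A' vs'"
    and \<alpha>: "\<And>i. i < length vs \<Longrightarrow> sat A' [vs' ! i] (f (vs ! i))"
    unfolding sat_scattered_sentence[OF fm] by (auto simp: scattered_def)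
  have "\<exists>g. ball_iso m r A [vs ! i] A' [vs' ! i] g" if i: "i < length vs" for i
  proof (rule local_family_ball_iso[OF C A])
    show "f (vs ! i) \<in> C r 1" "sat A [vs ! i] (f (vs ! i))" using f i by auto
    show "set [vs ! i] \<subseteq> universe A" using i vs(3) nth_mem[OF i] by auto
    have "vs' ! i \<in> set vs'" using i vs'(1) by simp
    then show "set [vs' ! i] \<subseteq> universe A'" using vs'(2) by auto
  qed (use \<alpha>[OF i] in auto)
  with vs' show ?thesis by blast
qed

lemma determined_by_Ex:
  fixes r :: nat
  assumes C: "local_family m V C" and \<phi>: "determined_by m V r \<Sigma> (Suc n) \<phi>"
  defines "\<rho> \<equiv> 2 * r + 1"
  shows "determined_by m V (4 * \<rho>) (\<Sigma> \<union> {scattered_sentence m \<rho> \<alpha>s |\<alpha>s.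
    set \<alpha>s \<subseteq> C \<rho> 1 \<and> length \<alpha>s \<le> Suc n \<and> \<alpha>s \<noteq> []}) n (Ex \<phi>)" (is "determined_by m V _ ?\<Sigma> n _")
proof -
  \<comment> \<open>One implication for arbitrary structures is enough: agreement is symmetric and
    the isomorphism can be inverted, so the converse follows by exchanging the two sides.\<close>
  have imp: "sat A' as' (Ex \<phi>)"
    if *: "A \<in> V" "A' \<in> V" "length as = n" "set as \<subseteq> universe A" "set as' \<subseteq> universe A'"
      "agree ?\<Sigma> A A'" "ball_iso m (4 * \<rho>) A as A' as' h" "sat A as (Ex \<phi>)" for A A' as as' h
  proof -
    obtain x where x: "x \<in> universe A" "sat A (x # as) \<phi>" using *(8) by auto
    have agr: "agree \<Sigma> A A'" "agree {scattered_sentence m \<rho> \<alpha>s |\<alpha>s.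
      set \<alpha>s \<subseteq> C \<rho> 1 \<and> length \<alpha>s \<le> Suc (length as) \<and> \<alpha>s \<noteq> []} A A'"
      using *(3,6) unfolding agree_def by blast+
    have "\<exists>x'\<in>universe A'. \<exists>h'. ball_iso m r A (x # as) A' (x' # as') h'"
      using *(7) unfolding \<rho>_def
      by (rule ball_iso_extend[OF _ *(4,5) x(1)])
        (rule scattered_transfer[OF C *(1,2) agr(2), unfolded \<rho>_def])
    then obtain x' h' where "x' \<in> universe A'" "ball_iso m r A (x # as) A' (x' # as') h'" by blast
    moreover have "sat A' (x' # as') \<phi>"
      using determined_byD[OF \<phi> *(1,2) _ _ _ agr(1) calculation(2)] *(3-5) x calculation(1) by auto
    ultimately show ?thesis by auto
  qed
  show ?thesis
    unfolding determined_by_def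
  proof (intro ballI allI impI, elim conjE)
    fix A A' as as' h
    assume *: "A \<in> V" "A' \<in> V" "length as = n" "set as \<subseteq> universe A" "set as' \<subseteq> universe A'"
      "agree ?\<Sigma> A A'" "ball_iso m (4 * \<rho>) A as A' as' h"
    have "length as' = n" using *(3,7) by (auto simp: ball_iso_def)
    moreover have "agree ?\<Sigma> A' A" using *(6) by (simp add: agree_def)
    ultimately show "sat A as (Ex \<phi>) \<longleftrightarrow> sat A' as' (Ex \<phi>)"
      using imp[OF *] imp[OF *(2,1) _ *(5,4) _ ball_iso_sym[OF *(7,4)]] by blast
  qed
qed

text \<open>Equations start with no sentences and a radius given by the size of their terms;
  connectives merge the data of their parts, and only quantifiers contribute new sentences.\<close>

lemma locality:
  assumes V: "\<forall>A\<in>V. is_structure m A" and C: "local_family m V C"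
  shows "is_formula m n \<phi> \<Longrightarrow>
    \<exists>r \<Sigma>. finite \<Sigma> \<and> (\<forall>\<sigma>\<in>\<Sigma>. local_sentence m C \<sigma>) \<and> determined_by m V r \<Sigma> n \<phi>"
proof (induction \<phi> arbitrary: n)
  have quant: "\<exists>r \<Sigma>. finite \<Sigma> \<and> (\<forall>\<sigma>\<in>\<Sigma>. local_sentence m C \<sigma>) \<and> determined_by m V r \<Sigma> n (Ex \<phi>)"
    if "finite \<Sigma>" "\<forall>\<sigma>\<in>\<Sigma>. local_sentence m C \<sigma>" "determined_by m V r \<Sigma> (Suc n) \<phi>" for r \<Sigma> n \<phi>
  proof -
    let ?\<rho> = "2 * r + 1"
    \<comment> \<open>Bounded length over the finite set \<open>C ?\<rho> 1\<close> keeps the number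
      of added sentences finite.\<close>
    let ?L = "{\<alpha>s. set \<alpha>s \<subseteq> C ?\<rho> 1 \<and> length \<alpha>s \<le> Suc n \<and> \<alpha>s \<noteq> []}"
    have "finite (C ?\<rho> 1)" using local_family_finite[OF C] .
    then have "finite ?L" by (rule rev_finite_subset[OF finite_lists_length_le]) auto
    then have "finite {scattered_sentence m ?\<rho> \<alpha>s |\<alpha>s.
      set \<alpha>s \<subseteq> C ?\<rho> 1 \<and> length \<alpha>s \<le> Suc n \<and> \<alpha>s \<noteq> []}"
      by (rule finite_image_set)
    moreover have "local_sentence m C (scattered_sentence m ?\<rho> \<alpha>s)" if "\<alpha>s \<in> ?L" for \<alpha>s
      unfolding local_sentence_def r_local_sentence_def using that by blast
    ultimately show ?thesis
      using determined_by_Ex[OF C that(3)] that(1,2)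
      by (intro exI[of _ "4 * ?\<rho>"] exI conjI) auto
  qed
  have bin: "\<exists>r \<Sigma>. finite \<Sigma> \<and> (\<forall>\<sigma>\<in>\<Sigma>. local_sentence m C \<sigma>) \<and>
      determined_by m V r \<Sigma> n \<phi> \<and> determined_by m V r \<Sigma> n \<psi>"
    if *: "\<exists>r \<Sigma>. finite \<Sigma> \<and> (\<forall>\<sigma>\<in>\<Sigma>. local_sentence m C \<sigma>) \<and> determined_by m V r \<Sigma> n \<phi>"
      "\<exists>r \<Sigma>. finite \<Sigma> \<and> (\<forall>\<sigma>\<in>\<Sigma>. local_sentence m C \<sigma>) \<and> determined_by m V r \<Sigma> n \<psi>" for n \<phi> \<psi>
  proof -
    obtain r1 \<Sigma>1 r2 \<Sigma>2 where loc: "finite \<Sigma>1" "\<forall>\<sigma>\<in>\<Sigma>1. local_sentence m C \<sigma>" "finite \<Sigma>2"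
      "\<forall>\<sigma>\<in>\<Sigma>2. local_sentence m C \<sigma>"
      and d: "determined_by m V r1 \<Sigma>1 n \<phi>" "determined_by m V r2 \<Sigma>2 n \<psi>"
      using * by metis
    \<comment> \<open>A larger radius and more sentences only strengthen the premise, so both parts
      can share the maximum and the union.\<close>
    have "determined_by m V (max r1 r2) (\<Sigma>1 \<union> \<Sigma>2) n \<phi>"
      "determined_by m V (max r1 r2) (\<Sigma>1 \<union> \<Sigma>2) n \<psi>"
      using determined_by_mono[OF d(1), of "max r1 r2" "\<Sigma>1 \<union> \<Sigma>2"]
        determined_by_mono[OF d(2), of "max r1 r2" "\<Sigma>1 \<union> \<Sigma>2"] by auto
    with loc show ?thesis by (intro exI[of _ "max r1 r2"] exI[of _ "\<Sigma>1 \<union> \<Sigma>2"]) auto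
  qed
  {
    case (Eq s t)
    then show ?case using determined_by_Eq[OF V, of n s t]
      by (intro exI[of _ "max (size s) (size t)"] exI[of _ "{}"]) simp
  next
    case Bot
    show ?case by (intro exI[of _ 0] exI[of _ "{}"]) (simp add: determined_by_def)
  next
    case (Neg \<phi>)
    then have "is_formula m n \<phi>" by simp
    from Neg.IH[OF this] obtain r \<Sigma> where
      loc: "finite \<Sigma>" "\<forall>\<sigma>\<in>\<Sigma>. local_sentence m C \<sigma>"
      and d: "determined_by m V r \<Sigma> n \<phi>"
      by (elim exE conjE) (rule that)
    show ?case using loc determined_by_not[OF d sat.simps(3)] by metis
  next
    case (And \<phi> \<psi>)
    then have "is_formula m n \<phi>" "is_formula m n \<psi>" by simp_all
    from bin[OF And.IH(1)[OF this(1)] And.IH(2)[OF this(2)]] obtain r \<Sigma> where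
      loc: "finite \<Sigma>" "\<forall>\<sigma>\<in>\<Sigma>. local_sentence m C \<sigma>"
      and d: "determined_by m V r \<Sigma> n \<phi>" "determined_by m V r \<Sigma> n \<psi>"
      by (elim exE conjE) (rule that)
    show ?case
      using loc determined_by_binary[where f = "(\<and>)", OF d sat.simps(4)] by metis
  next
    case (Or \<phi> \<psi>)
    then have "is_formula m n \<phi>" "is_formula m n \<psi>" by simp_all
    from bin[OF Or.IH(1)[OF this(1)] Or.IH(2)[OF this(2)]] obtain r \<Sigma> where
      loc: "finite \<Sigma>" "\<forall>\<sigma>\<in>\<Sigma>. local_sentence m C \<sigma>"
      and d: "determined_by m V r \<Sigma> n \<phi>" "determined_by m V r \<Sigma> n \<psi>"
      by (elim exE conjE) (rule that)
    show ?case
      using loc determined_by_binary[where f = "(\<or>)", OF d sat.simps(5)] by metis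
  next
    case (Ex \<phi>)
    then have "is_formula m (Suc n) \<phi>" by simp
    from Ex.IH[OF this] show ?case by (elim exE conjE) (rule quant)
  next
    case (All \<phi>)
    then have "is_formula m (Suc n) \<phi>" by simp
    from All.IH[OF this] obtain r \<Sigma> where "finite \<Sigma>" "\<forall>\<sigma>\<in>\<Sigma>. local_sentence m C \<sigma>"
      "determined_by m V r \<Sigma> (Suc n) \<phi>"
      by (elim exE conjE) (rule that)
    from quant[OF this(1,2) determined_by_not[OF this(3) sat.simps(3)]] obtain r \<Sigma> where
      loc: "finite \<Sigma>" "\<forall>\<sigma>\<in>\<Sigma>. local_sentence m C \<sigma>"
      and d: "determined_by m V r \<Sigma> n (Ex (Neg \<phi>))"
      by (elim exE conjE) (rule that)
    have "determined_by m V r \<Sigma> n (All \<phi>)" by (rule determined_by_not[OF d]) simp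
    with loc show ?case by metis
  }
qed

section \<open>Normal forms\<close>

lemma is_term_rename_term:
  "is_term m n t \<Longrightarrow> \<forall>k<n. \<sigma> k < n' \<Longrightarrow> is_term m n' (rename_term \<sigma> t)"
  by (induction t) auto

lemma is_formula_rename:
  "is_formula m n \<phi> \<Longrightarrow> \<forall>k<n. \<sigma> k < n' \<Longrightarrow> is_formula m n' (rename \<sigma> \<phi>)"
proof (induction \<phi> arbitrary: n n' \<sigma>)
  case (Ex \<phi>)
  have "\<forall>k<Suc n. case_nat 0 (Suc \<circ> \<sigma>) k < Suc n'" using Ex.prems(2) by (simp split: nat.split)
  then show ?case using Ex.IH[of "Suc n"] Ex.prems(1) by simp
next
  case (All \<phi>)
  have "\<forall>k<Suc n. case_nat 0 (Suc \<circ> \<sigma>) k < Suc n'" using All.prems(2) by (simp split: nat.split)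
  then show ?case using All.IH[of "Suc n"] All.prems(1) by simp
qed (auto intro: is_term_rename_term)

lemma rename_term_id: "rename_term id t = t"
  by (induction t) auto

lemma rename_id: "rename id \<phi> = \<phi>"
proof -
  have "case_nat 0 (Suc \<circ> id) = id" by (auto simp: fun_eq_iff split: nat.split)
  then show ?thesis by (induction \<phi>) (simp_all add: rename_term_id)
qed

lemma is_formula_mono: "is_formula m n \<phi> \<Longrightarrow> n \<le> n' \<Longrightarrow> is_formula m n' \<phi>"
  using is_formula_rename[of m n \<phi> id n'] by (simp add: rename_id)

text \<open>In a normal form the local sentences stand beside a formula with free variables and are
  evaluated at its tuple.\<close>

lemma sat_sentence: "is_formula m 0 \<phi> \<Longrightarrow> sat A as \<phi> \<longleftrightarrow> sat A [] \<phi>"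
  using sat_rename[of m "[]" \<phi> as id A] by (simp add: rename_id)

lemma is_formula_Conjs [simp]: "is_formula m n (Conjs \<phi>s) \<longleftrightarrow> (\<forall>\<phi>\<in>set \<phi>s. is_formula m n \<phi>)"
  by (induction \<phi>s) (auto simp: Conjs_def)

lemma is_formula_Disjs [simp]: "is_formula m n (Disjs \<phi>s) \<longleftrightarrow> (\<forall>\<phi>\<in>set \<phi>s. is_formula m n \<phi>)"
  by (induction \<phi>s) (auto simp: Disjs_def)

lemma is_formula_Ex_pow [simp]: "is_formula m k ((Ex ^^ n) \<phi>) \<longleftrightarrow> is_formula m (n + k) \<phi>"
  by (induction n arbitrary: k) auto

lemma is_formula_dist_le_fm: "x < n \<Longrightarrow> y < n \<Longrightarrow> is_formula m n (dist_le_fm m k x y)"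
  by (induction k arbitrary: n x y) (auto simp: adj_fm_def)

lemma local_sentence_is_formula:
  assumes C: "local_family m V C" and "local_sentence m C \<sigma>"
  shows "is_formula m 0 \<sigma>"
proof -
  have "is_formula m 0 (scattered_sentence m r \<alpha>s)" if "set \<alpha>s \<subseteq> C r 1" for r \<alpha>s
  proof -
    have "is_formula m (length \<alpha>s) (rename (\<lambda>_. i) (\<alpha>s ! i))" if "i < length \<alpha>s" for i
    proof (rule is_formula_rename)
      show "is_formula m 1 (\<alpha>s ! i)"
        using local_family_formula[OF C] \<open>set \<alpha>s \<subseteq> C r 1\<close> nth_mem[OF that] by blast
    qed (use that in simp)
    then show ?thesis
      by (auto simp: scattered_sentence_def Let_def dist_gt_fm_def intro!: is_formula_dist_le_fm)
  qed
  then show ?thesis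
    using assms(2) local_family_formula[OF C, of _ _ 1]
    unfolding local_sentence_def r_local_sentence_def by auto
qed

section \<open>Boolean combinations and truth patterns\<close>

lemma bool_comb_Conjs: "\<forall>\<phi>\<in>set \<phi>s. bool_comb P \<phi> \<Longrightarrow> bool_comb P (Conjs \<phi>s)"
  by (induction \<phi>s) (auto simp: Conjs_def intro: bool_comb.intros)

lemma bool_comb_Disjs: "\<forall>\<phi>\<in>set \<phi>s. bool_comb P \<phi> \<Longrightarrow> bool_comb P (Disjs \<phi>s)"
  by (induction \<phi>s) (auto simp: Disjs_def intro: bool_comb.intros)

text \<open>A complete truth pattern as a list of literals, with \<open>\<Delta>\<close> the set of
  sentences declared true.\<close>

definition literals :: "fm list \<Rightarrow> fm set \<Rightarrow> fm list" where
  "literals \<sigma>s \<Delta> = map (\<lambda>\<sigma>. if \<sigma> \<in> \<Delta> then \<sigma> else Neg \<sigma>) \<sigma>s"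

lemma sat_literals:
  assumes "\<forall>\<sigma>\<in>set \<sigma>s. is_formula m 0 \<sigma>"
  shows "(\<forall>\<beta>\<in>set (literals \<sigma>s \<Delta>). sat A as \<beta>) \<longleftrightarrow> (\<forall>\<sigma>\<in>set \<sigma>s. sat A [] \<sigma> \<longleftrightarrow> \<sigma> \<in> \<Delta>)"
proof -
  have "sat A as \<sigma> \<longleftrightarrow> sat A [] \<sigma>" if "\<sigma> \<in> set \<sigma>s" for \<sigma>
    using assms that by (intro sat_sentence) blast
  then have "sat A as (if \<sigma> \<in> \<Delta> then \<sigma> else Neg \<sigma>) \<longleftrightarrow> (sat A [] \<sigma> \<longleftrightarrow> \<sigma> \<in> \<Delta>)"
    if "\<sigma> \<in> set \<sigma>s" for \<sigma>
    using that by simp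
  then show ?thesis
    unfolding literals_def set_map Ball_image_comp o_def by (intro ball_cong refl)
qed

lemma equivalent_over_theory_of:
  assumes "is_formula m n \<phi>" "is_formula m n \<psi>"
    and "\<And>A as. A \<in> V \<Longrightarrow> length as = n \<Longrightarrow> set as \<subseteq> universe A \<Longrightarrow> sat A as \<phi> \<longleftrightarrow> sat A as \<psi>"
  shows "equivalent_over (theory_of m V) n \<phi> \<psi>"
  using assms by (auto simp: equivalent_over_def theory_of_def sat_All_pow)

lemma local_normal_form_bool_comb:
  assumes "local_normal_form m C n \<phi>"
  shows "bool_comb (\<lambda>\<psi>. local_sentence m C \<psi> \<or> local_formula C n \<psi>) \<phi>"
proof -
  obtain ds where ds: "\<phi> = Disjs [And \<alpha> (Conjs \<beta>s). (\<alpha>, \<beta>s) \<leftarrow> ds]"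
    and loc: "\<And>\<alpha> \<beta>s. (\<alpha>, \<beta>s) \<in> set ds \<Longrightarrow> local_formula C n \<alpha> \<and>
      (\<forall>\<beta>\<in>set \<beta>s. local_sentence m C \<beta> \<or> (\<exists>\<gamma>. local_sentence m C \<gamma> \<and> \<beta> = Neg \<gamma>))"
    using assms unfolding local_normal_form_def by blast
  let ?P = "\<lambda>\<psi>. local_sentence m C \<psi> \<or> local_formula C n \<psi>"
  have "bool_comb ?P (And \<alpha> (Conjs \<beta>s))" if "(\<alpha>, \<beta>s) \<in> set ds" for \<alpha> \<beta>s
  proof (intro bool_comb.conj bool_comb_Conjs ballI)
    show "bool_comb ?P \<alpha>" using loc[OF that] by (simp add: bool_comb.atom)
    show "bool_comb ?P \<beta>" if "\<beta> \<in> set \<beta>s" for \<beta>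
      using loc[OF \<open>(\<alpha>, \<beta>s) \<in> set ds\<close>] that bool_comb.atom[of ?P] bool_comb.neg[of ?P] by metis
  qed
  then show ?thesis unfolding ds by (intro bool_comb_Disjs) auto
qed

text \<open>There is one disjunct for each pair of a local formula and a truth pattern on
  \<open>\<Sigma>\<close> that occurs together with \<open>\<phi>\<close> somewhere in
  \<open>V\<close>. There are finitely many pairs, and such a pair forces \<open>\<phi>\<close>
  wherever it holds.\<close>

lemma ex_local_normal_form:
  assumes V: "\<forall>A\<in>V. is_structure m A" and C: "local_family m V C" and \<phi>: "is_formula m n \<phi>"
  shows "\<exists>\<phi>'. local_normal_form m C n \<phi>' \<and> equivalent_over (theory_of m V) n \<phi> \<phi>'"
proof -
  obtain r \<Sigma> where "finite \<Sigma>" and loc: "\<forall>\<sigma>\<in>\<Sigma>. local_sentence m C \<sigma>"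
    and det: "determined_by m V r \<Sigma> n \<phi>"
    using locality[OF V C \<phi>] by blast
  then obtain \<sigma>s where \<sigma>s: "set \<sigma>s = \<Sigma>" using finite_list by blast
  have sen: "\<forall>\<sigma>\<in>set \<sigma>s. is_formula m 0 \<sigma>"
    using local_sentence_is_formula[OF C] loc \<sigma>s by blast
  define realized where "realized = (\<lambda>\<alpha> \<Delta>. \<exists>A\<in>V. \<exists>as. length as = n \<and> set as \<subseteq> universe A \<and>
    sat A as \<alpha> \<and> sat A as \<phi> \<and> (\<forall>\<sigma>\<in>\<Sigma>. sat A [] \<sigma> \<longleftrightarrow> \<sigma> \<in> \<Delta>))"
  define D where "D = (\<lambda>(\<alpha>, \<Delta>). (\<alpha>, literals \<sigma>s \<Delta>)) ` {(\<alpha>, \<Delta>) \<in> C r n \<times> Pow \<Sigma>. realized \<alpha> \<Delta>}"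
  have "finite (C r n)" using local_family_finite[OF C] .
  then have "finite {(\<alpha>, \<Delta>) \<in> C r n \<times> Pow \<Sigma>. realized \<alpha> \<Delta>}"
    using \<open>finite \<Sigma>\<close> by (auto intro: rev_finite_subset[of "C r n \<times> Pow \<Sigma>"])
  then have "finite D" unfolding D_def by (rule finite_imageI)
  then obtain ds where ds: "set ds = D" using finite_list by blast
  let ?\<phi>' = "Disjs [And \<alpha> (Conjs \<beta>s). (\<alpha>, \<beta>s) \<leftarrow> ds]"
  have nf: "local_normal_form m C n ?\<phi>'"
    unfolding local_normal_form_def
    using ds loc \<sigma>s by (intro exI[of _ ds]) (auto simp: D_def local_formula_def literals_def)
  have fm: "is_formula m n ?\<phi>'"
    using ds sen is_formula_mono[of m 0 _ n] local_family_formula[OF C]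
    by (auto simp: D_def literals_def)
  have sat: "sat A as ?\<phi>' \<longleftrightarrow>
      (\<exists>\<alpha>\<in>C r n. \<exists>\<Delta>\<subseteq>\<Sigma>. realized \<alpha> \<Delta> \<and> sat A as \<alpha> \<and> (\<forall>\<sigma>\<in>\<Sigma>. sat A [] \<sigma> \<longleftrightarrow> \<sigma> \<in> \<Delta>))" for A as
  proof -
    have "sat A as ?\<phi>' \<longleftrightarrow> (\<exists>(\<alpha>, \<beta>s)\<in>D. sat A as \<alpha> \<and> (\<forall>\<beta>\<in>set \<beta>s. sat A as \<beta>))"
      by (simp add: ds[symmetric] case_prod_unfold)
    also have "\<dots> \<longleftrightarrow> (\<exists>\<alpha>\<in>C r n. \<exists>\<Delta>\<subseteq>\<Sigma>. realized \<alpha> \<Delta> \<and> sat A as \<alpha> \<and>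
        (\<forall>\<beta>\<in>set (literals \<sigma>s \<Delta>). sat A as \<beta>))"
      unfolding D_def by auto
    finally show ?thesis unfolding sat_literals[OF sen] \<sigma>s .
  qed
  have "sat A as \<phi> \<longleftrightarrow> sat A as ?\<phi>'"
    if as: "A \<in> V" "length as = n" "set as \<subseteq> universe A" for A as
  proof
    assume \<phi>: "sat A as \<phi>"
    obtain \<alpha> where \<alpha>: "\<alpha> \<in> C r n" "sat A as \<alpha>" using local_family_ex[OF C as] by blast
    define \<Delta> where "\<Delta> = {\<sigma>\<in>\<Sigma>. sat A [] \<sigma>}"
    have \<Delta>: "\<Delta> \<subseteq> \<Sigma>" "\<forall>\<sigma>\<in>\<Sigma>. sat A [] \<sigma> \<longleftrightarrow> \<sigma> \<in> \<Delta>" by (auto simp: \<Delta>_def)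
    have "realized \<alpha> \<Delta>"
      unfolding realized_def using as \<alpha> \<phi> \<Delta> by (intro bexI[of _ A] exI[of _ as] conjI)
    then show "sat A as ?\<phi>'"
      unfolding sat using \<alpha> \<Delta> by (intro bexI[of _ \<alpha>] exI[of _ \<Delta>] conjI)
  next
    assume "sat A as ?\<phi>'"
    then obtain \<alpha> \<Delta> where \<alpha>: "\<alpha> \<in> C r n" "realized \<alpha> \<Delta>" "sat A as \<alpha>"
      "\<forall>\<sigma>\<in>\<Sigma>. sat A [] \<sigma> \<longleftrightarrow> \<sigma> \<in> \<Delta>"
      unfolding sat by (elim bexE exE conjE) (rule that)
    then obtain A' as' where A': "A' \<in> V" "length as' = n" "set as' \<subseteq> universe A'" "sat A' as' \<alpha>"
      "sat A' as' \<phi>" "\<forall>\<sigma>\<in>\<Sigma>. sat A' [] \<sigma> \<longleftrightarrow> \<sigma> \<in> \<Delta>"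
      unfolding realized_def by (elim bexE exE conjE) (rule that)
    \<comment> \<open>Sharing \<open>\<alpha>\<close> gives isomorphic balls and sharing
      \<open>\<Delta>\<close> gives agreement on \<open>\<Sigma>\<close>, so \<open>\<phi>\<close>
      carries over from the realizing tuple \<open>as'\<close> to \<open>as\<close>.\<close>
    obtain h where "ball_iso m r A as A' as' h"
      using local_family_ball_iso[OF C as(1) A'(1) \<alpha>(1) as(2) A'(2) as(3) A'(3) \<alpha>(3) A'(4)] by blast
    moreover have "agree \<Sigma> A A'" using \<alpha>(4) A'(6) by (simp add: agree_def)
    ultimately show "sat A as \<phi>" using determined_byD[OF det as(1) A'(1) as(2,3) A'(3)] A'(5) by blast
  qed
  then have "equivalent_over (theory_of m V) n \<phi> ?\<phi>'" by (rule equivalent_over_theory_of[OF \<phi> fm])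
  with nf show ?thesis by (intro exI[of _ ?\<phi>'] conjI)
qed

text \<open>
  For a sentence the local formulas in the normal form, which come from \<open>C\<^sub>r\<^sub>,\<^sub>0\<close>, are dispensable,
  since balls around the empty tuple are empty.
\<close>

lemma ex_local_sentence_comb:
  fixes V :: "'a struct set"
  assumes V: "\<forall>A\<in>V. is_structure m A" and C: "local_family m V C" and \<phi>: "is_formula m 0 \<phi>"
  shows "\<exists>\<phi>'. bool_comb (local_sentence m C) \<phi>' \<and> equivalent_over (theory_of m V) 0 \<phi> \<phi>'"
proof -
  obtain r \<Sigma> where "finite \<Sigma>" and loc: "\<forall>\<sigma>\<in>\<Sigma>. local_sentence m C \<sigma>"
    and det: "determined_by m V r \<Sigma> 0 \<phi>"
    using locality[OF V C \<phi>] by blast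
  then obtain \<sigma>s where \<sigma>s: "set \<sigma>s = \<Sigma>" using finite_list by blast
  have sen: "\<forall>\<sigma>\<in>set \<sigma>s. is_formula m 0 \<sigma>"
    using local_sentence_is_formula[OF C] loc \<sigma>s by blast
  \<comment> \<open>The disjuncts will be the truth patterns of the models of \<open>\<phi>\<close>
    in \<open>V\<close>; being subsets of \<open>\<Sigma>\<close>, they are finite in number even if
    \<open>V\<close> is not.\<close>
  define profile where "profile = (\<lambda>A :: 'a struct. {\<sigma>\<in>\<Sigma>. sat A [] \<sigma>})"
  define D where "D = {profile A |A. A \<in> V \<and> sat A [] \<phi>}"
  have "D \<subseteq> Pow \<Sigma>" by (auto simp: D_def profile_def)
  then have "finite D" using \<open>finite \<Sigma>\<close> finite_subset by blast
  then obtain ds where ds: "set ds = D" using finite_list by blast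
  let ?\<phi>' = "Disjs [Conjs (literals \<sigma>s \<Delta>). \<Delta> \<leftarrow> ds]"
  have comb: "bool_comb (local_sentence m C) ?\<phi>'"
  proof (intro bool_comb_Disjs ballI)
    fix \<psi> assume "\<psi> \<in> set [Conjs (literals \<sigma>s \<Delta>). \<Delta> \<leftarrow> ds]"
    then obtain \<Delta> where \<psi>: "\<psi> = Conjs (literals \<sigma>s \<Delta>)" by auto
    have "bool_comb (local_sentence m C) \<sigma> \<and> bool_comb (local_sentence m C) (Neg \<sigma>)"
      if "\<sigma> \<in> set \<sigma>s" for \<sigma>
      using loc \<sigma>s that by (simp add: bool_comb.atom bool_comb.neg)
    then show "bool_comb (local_sentence m C) \<psi>"
      unfolding \<psi> by (intro bool_comb_Conjs) (auto simp: literals_def)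
  qed
  have fm: "is_formula m 0 ?\<phi>'" using sen by (auto simp: literals_def)
  moreover have "sat A [] \<phi> \<longleftrightarrow> sat A [] ?\<phi>'" if A: "A \<in> V" for A
  proof -
    \<comment> \<open>Any map is an isomorphism between empty balls, so agreement on
      \<open>\<Sigma>\<close> alone decides \<open>\<phi>\<close>.\<close>
    have "ball_iso m r A [] A' [] h" for A' :: "'a struct" and h
      by (simp add: ball_iso_def rel_iso_def gball_def bij_betw_def)
    then have agree: "sat A [] \<phi> \<longleftrightarrow> sat A' [] \<phi>" if "A' \<in> V" "agree \<Sigma> A A'" for A'
      using determined_byD[OF det A that(1), of "[]" "[]"] that(2) by simp
    have self: "agree \<Sigma> A A" by (simp add: agree_def)
    have "sat A [] ?\<phi>' \<longleftrightarrow> (\<exists>\<Delta>\<in>D. \<forall>\<sigma>\<in>\<Sigma>. sat A [] \<sigma> \<longleftrightarrow> \<sigma> \<in> \<Delta>)"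
      using sat_literals[OF sen, of _ A "[]"] by (simp add: ds \<sigma>s)
    also have "\<dots> \<longleftrightarrow> (\<exists>A'\<in>V. sat A' [] \<phi> \<and> agree \<Sigma> A A')"
      by (auto simp: D_def profile_def agree_def)
    \<comment> \<open>From right to left \<open>A\<close> serves as its own witness.\<close>
    also have "\<dots> \<longleftrightarrow> sat A [] \<phi>" using agree A self by blast
    finally show ?thesis by simp
  qed
  ultimately have "equivalent_over (theory_of m V) 0 \<phi> ?\<phi>'"
    by (intro equivalent_over_theory_of[OF \<phi>]) auto
  with comb show ?thesis by (intro exI[of _ ?\<phi>'] conjI)
qed

theorem theorem4p10:
  fixes m :: nat
    and E :: "fm set"
    and V :: "'a::infinite struct set"
    and T :: "fm set"
    and C :: "nat \<Rightarrow> nat \<Rightarrow> fm set"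
  assumes E: "\<forall>\<psi>\<in>E. equation_axiom m \<psi>"
    and V: "V = Mod m E"
    and T: "T = theory_of m V"
    and bij: "generalized_bijective m T"
    and C: "local_family m V C"
  shows "(\<forall>\<phi>. is_formula m 0 \<phi> \<longrightarrow>
            (\<exists>\<phi>'. bool_comb (local_sentence m C) \<phi>' \<and> equivalent_over T 0 \<phi> \<phi>')) \<and>
         (\<forall>n \<phi>. is_formula m n \<phi> \<longrightarrow>
            (\<exists>\<phi>'. bool_comb (\<lambda>\<psi>. local_sentence m C \<psi> \<or> local_formula C n \<psi>) \<phi>' \<and>
                  local_normal_form m C n \<phi>' \<and>
                  equivalent_over T n \<phi> \<phi>'))"
proof -
  have str: "\<forall>A\<in>V. is_structure m A" using V by (auto simp: Mod_def)
  show ?thesis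
    unfolding T
    using ex_local_sentence_comb[OF str C] ex_local_normal_form[OF str C]
      local_normal_form_bool_comb[of m C]
    by metis
qed

end
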